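(* There is a constant $C>0$, independent of $h$, such that $$\inf_{0\ne v_h\in V_{h,0}}\ \sup_{0\ne\sigma_h\in\Sigma_{h,0}}\frac{(\operatorname{div}_h\sigma_h,v_h)}{\|\sigma_h\|_{H(\operatorname{div}_h)}\,\|v_h\|_0}\ \ge\ C .$$
   Context: Let $\Omega=(0,1)^2$ with $\Gamma=\partial\Omega$, and let $\mathcal T_h$ be the uniform grid of $N\times N$ squares of side $h=1/N$ ($N$ a positive integer). $\mathbb S$ denotes the symmetric $2\times2$ real matrices; $(\cdot,\cdot)$ and $\|\cdot\|_0$ are the $L^2(\Omega)$ inner product and norm for vector or matrix (Frobenius product) valued functions. $\mathcal E_h$ is the set of all edges of $\mathcal T_h$; $m_e$ is the midpoint of $e\in\mathcal E_h$; $n$ is a unit normal of $e$; an edge is interior if it is not contained in $\Gamma$. On each $K\in\mathcal T_h$ let $\Sigma_K$ be the set of symmetric matrix functions $\begin{pmatrix}\sigma_{11}&\sigma_{12}\\ \sigma_{12}&\sigma_{22}\end{pmatrix}$ on $K$ with $\sigma_{11}\in\operatorname{span}\{1,x\}$, $\sigma_{22}\in\operatorname{span}\{1,y\}$, $\sigma_{12}\in\operatorname{span}\{1,x,y\}$. Define - $\Sigma_h$: the set of $\sigma\in L^2(\Omega,\mathbb S)$ with $\sigma|_K\in\Sigma_K$ for all $K\in\mathcal T_h$, such that $\sigma_{11}$ is continuous across all vertical interior edges, $\sigma_{22}$ is continuous across all horizontal interior edges, and $\sigma_{12}$ is continuous at the midpoints of all interior edges; - $V_h$: the set of $v\in L^2(\Omega,\mathbb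 R^2)$ that are constant on each $K\in\mathcal T_h$; - $\mathrm{RM}=\operatorname{span}\left\{\begin{pmatrix}1\\0\end{pmatrix},\begin{pmatrix}0\\1\end{pmatrix},\begin{pmatrix}y\\-x\end{pmatrix}\right\}$ (rigid motions); - $\Sigma_{h,0}=\{\sigma\in\Sigma_h:\ \sigma(m_e)\,n=0\ \text{for every edge } e\in\mathcal E_h \text{ with } e\subset\Gamma\}$; - $V_{h,0}=\{v\in V_h:\ (v,w)=0\ \ \forall w\in\mathrm{RM}\}$. $\operatorname{div}_h$ is the elementwise (row-wise) divergence, $(\operatorname{div}_h\tau)|_K=\operatorname{div}(\tau|_K)$, and $\|\tau\|_{H(\operatorname{div}_h)}=(\|\tau\|_0^2+\|\operatorname{div}_h\tau\|_0^2)^{1/2}$. The infimum over the empty set is $+\infty$ (this occurs only for $N=1$, where $V_{h,0}=\{0\}$). *)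

theory Defs
  imports "HOL-Analysis.Analysis"
begin

text \<open>
  Elements of \<open>L\<^sup>2(\<Omega>)\<close> are represented by functions on the plane of which only the
  values on \<open>\<Omega>\<close> matter, up to null sets. A piecewise polynomial function is given by a representative
  that agrees with the respective polynomial everywhere on each open cell; its values on
  the grid lines are arbitrary. The norm and the inner product of \<open>real^2^2\<close> are
  the Frobenius ones.
\<close>

abbreviation pt :: "real \<Rightarrow> real \<Rightarrow> real^2" where
  "pt a b \<equiv> vector [a, b]"

definition Om :: "(real^2) set" where
  "Om = box (pt 0 0) (pt 1 1)"

definition SymMat :: "(real^2^2) set" where
  "SymMat = {A. transpose A = A}"

definition L2_Om :: "'b set \<Rightarrow> (real^2 \<Rightarrow> 'b::euclidean_space) set" where
  "L2_Om S = {f. f \<in> borel_measurable (lebesgue_on Om)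
               \<and> integrable (lebesgue_on Om) (\<lambda>x. (norm (f x))\<^sup>2)
               \<and> (AE x in lebesgue_on Om. f x \<in> S)}"

definition L2_inner :: "(real^2 \<Rightarrow> 'b::euclidean_space) \<Rightarrow> (real^2 \<Rightarrow> 'b) \<Rightarrow> real" where
  "L2_inner f g = (LINT x|lebesgue_on Om. f x \<bullet> g x)"

definition L2_norm :: "(real^2 \<Rightarrow> 'b::euclidean_space) \<Rightarrow> real" where
  "L2_norm f = sqrt (L2_inner f f)"

definition L2_zero :: "(real^2 \<Rightarrow> 'b::euclidean_space) \<Rightarrow> bool" where
  "L2_zero f \<longleftrightarrow> (AE x in lebesgue_on Om. f x = 0)"

definition mesh :: "nat \<Rightarrow> (real^2) set set" where
  "mesh N = {cbox (pt (real i / real N) (real j / real N))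
                  (pt (real (i + 1) / real N) (real (j + 1) / real N)) | i j. i < N \<and> j < N}"

text \<open>An edge is represented by the ordered pair of its end points.\<close>

definition vertical_edges :: "nat \<Rightarrow> ((real^2) \<times> (real^2)) set" where
  "vertical_edges N = {(pt (real i / real N) (real j / real N),
                        pt (real i / real N) (real (j + 1) / real N)) | i j. i \<le> N \<and> j < N}"

definition horizontal_edges :: "nat \<Rightarrow> ((real^2) \<times> (real^2)) set" where
  "horizontal_edges N = {(pt (real i / real N) (real j / real N),
                          pt (real (i + 1) / real N) (real j / real N)) | i j. i < N \<and> j \<le> N}"

definition edges :: "nat \<Rightarrow> ((real^2) \<times> (real^2)) set" where
  "edges N = vertical_edges N \<union> horizontal_edges N"

definition edge_set :: "(real^2) \<times> (real^2) \<Rightarrow> (real^2) set" where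
  "edge_set e = closed_segment (fst e) (snd e)"

definition edge_mid :: "(real^2) \<times> (real^2) \<Rightarrow> real^2" where
  "edge_mid e = midpoint (fst e) (snd e)"

definition unit_normal :: "(real^2) \<times> (real^2) \<Rightarrow> real^2 \<Rightarrow> bool" where
  "unit_normal e n \<longleftrightarrow> norm n = 1 \<and> n \<bullet> (snd e - fst e) = 0"

definition boundary_edge :: "(real^2) \<times> (real^2) \<Rightarrow> bool" where
  "boundary_edge e \<longleftrightarrow> edge_set e \<subseteq> frontier Om"

definition Sigma_loc :: "(real^2) set \<Rightarrow> (real^2 \<Rightarrow> real^2^2) set" where
  "Sigma_loc K = {\<sigma>. \<exists>a b c d p q r. \<forall>x\<in>interior K.
      \<sigma> x $ 1 $ 1 = a + b * x$1 \<and>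
      \<sigma> x $ 2 $ 2 = c + d * x$2 \<and>
      \<sigma> x $ 1 $ 2 = p + q * x$1 + r * x$2 \<and>
      \<sigma> x $ 2 $ 1 = \<sigma> x $ 1 $ 2}"

text \<open>The value at \<open>x \<in> K\<close> (possibly on the boundary of the cell) of the restriction to \<open>K\<close>.\<close>

definition trace_from :: "(real^2) set \<Rightarrow> (real^2 \<Rightarrow> real^2^2) \<Rightarrow> real^2 \<Rightarrow> real^2^2" where
  "trace_from K \<sigma> x = Lim (at x within interior K) \<sigma>"

definition comp_continuous_at ::
    "nat \<Rightarrow> (real^2 \<Rightarrow> real^2^2) \<Rightarrow> 2 \<Rightarrow> 2 \<Rightarrow> (real^2) \<times> (real^2) \<Rightarrow> real^2 \<Rightarrow> bool" where
  "comp_continuous_at N \<sigma> i j e x \<longleftrightarrow>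
     (\<forall>K\<in>mesh N. \<forall>K'\<in>mesh N. edge_set e \<subseteq> K \<and> edge_set e \<subseteq> K' \<longrightarrow>
        trace_from K \<sigma> x $ i $ j = trace_from K' \<sigma> x $ i $ j)"

definition Sigma_h :: "nat \<Rightarrow> (real^2 \<Rightarrow> real^2^2) set" where
  "Sigma_h N = {\<sigma> \<in> L2_Om SymMat.
      (\<forall>K\<in>mesh N. \<sigma> \<in> Sigma_loc K) \<and>
      (\<forall>e\<in>vertical_edges N. \<not> boundary_edge e \<longrightarrow>
         (\<forall>x\<in>edge_set e. comp_continuous_at N \<sigma> 1 1 e x)) \<and>
      (\<forall>e\<in>horizontal_edges N. \<not> boundary_edge e \<longrightarrow>
         (\<forall>x\<in>edge_set e. comp_continuous_at N \<sigma> 2 2 e x)) \<and>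
      (\<forall>e\<in>edges N. \<not> boundary_edge e \<longrightarrow> comp_continuous_at N \<sigma> 1 2 e (edge_mid e))}"

definition V_h :: "nat \<Rightarrow> (real^2 \<Rightarrow> real^2) set" where
  "V_h N = {v \<in> L2_Om UNIV. \<forall>K\<in>mesh N. \<exists>c. \<forall>x\<in>interior K. v x = c}"

definition RM :: "(real^2 \<Rightarrow> real^2) set" where
  "RM = {(\<lambda>x. a *\<^sub>R vector [1, 0] + b *\<^sub>R vector [0, 1] + c *\<^sub>R vector [x$2, - (x$1)]) | a b c. True}"

definition Sigma_h0 :: "nat \<Rightarrow> (real^2 \<Rightarrow> real^2^2) set" where
  "Sigma_h0 N = {\<sigma> \<in> Sigma_h N. \<forall>e\<in>edges N. boundary_edge e \<longrightarrow>
      (\<forall>K\<in>mesh N. edge_set e \<subseteq> K \<longrightarrow>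
         (\<forall>n. unit_normal e n \<longrightarrow> trace_from K \<sigma> (edge_mid e) *v n = 0))}"

definition V_h0 :: "nat \<Rightarrow> (real^2 \<Rightarrow> real^2) set" where
  "V_h0 N = {v \<in> V_h N. \<forall>w\<in>RM. L2_inner v w = 0}"

definition div_row :: "(real^2 \<Rightarrow> real^2^2) \<Rightarrow> real^2 \<Rightarrow> real^2" where
  "div_row \<tau> x = (\<chi> i. \<Sum>j\<in>UNIV. frechet_derivative (\<lambda>y. \<tau> y $ i $ j) (at x) (axis j 1))"

definition div_h :: "nat \<Rightarrow> (real^2 \<Rightarrow> real^2^2) \<Rightarrow> real^2 \<Rightarrow> real^2" where
  "div_h N \<tau> x = (if \<exists>K\<in>mesh N. x \<in> interior K then div_row \<tau> x else 0)"

definition Hdiv_norm :: "nat \<Rightarrow> (real^2 \<Rightarrow> real^2^2) \<Rightarrow> real" where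
  "Hdiv_norm N \<tau> = sqrt ((L2_norm \<tau>)\<^sup>2 + (L2_norm (div_h N \<tau>))\<^sup>2)"

end

theory Submission
  imports Defs
begin

text \<open>
  For every piecewise constant load \<open>v\<close> orthogonal to the rigid motions there is an explicit
  discrete stress \<open>\<sigma>\<close> with \<open>div_h N \<sigma> = v\<close> on every cell and
  \<open>\<parallel>\<sigma>\<parallel>\<^sup>2 \<le> 9999 \<parallel>v\<parallel>\<^sup>2\<close> in L2 (lemma \<open>bounded_right_inverse_div_h\<close>). For this
  stress the quotient in the theorem is at least \<open>\<parallel>v\<parallel>\<^sup>2 / (100 \<parallel>v\<parallel>\<^sup>2)\<close>, so the inf-sup constant
  is at least \<open>1 / 100\<close>. No Korn inequality and no regularity theory is needed.

  The construction works on the degrees of freedom. Write \<open>v = (f, g)\<close> on the cells and \<open>h = 1/N\<close>.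
  A stress is given by values \<open>a\<close> of its first diagonal entry on the vertical edges, values \<open>b\<close> of
  the second one on the horizontal edges, and vertex values \<open>c\<close>: the off-diagonal entry at the
  midpoint of an edge is the mean of \<open>c\<close> over the end points of the edge. All continuity and boundary
  conditions are met if \<open>a\<close>, \<open>b\<close>, \<open>c\<close> vanish on the boundary, and \<open>div_h N \<sigma> = v\<close> becomes two
  families of difference equations. If \<open>c\<close> is known, then \<open>a\<close> is obtained by summation of the first
  equation along each row, and it vanishes at the right end exactly if \<open>c\<close> balances the total load
  on the row; likewise for \<open>b\<close> and the columns (lemma \<open>normal_stress_row\<close>).

  So only the row sums and the column sums of \<open>c\<close> matter: \<open>h \<Sum>\<^sub>i c i j\<close> has to be the partial sum
  \<open>C j\<close> of the row loads, and \<open>h \<Sum>\<^sub>j c i j\<close> the partial sum \<open>D i\<close> of the column loads. The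
  orthogonality of \<open>v\<close> to the translations makes \<open>C\<close> and \<open>D\<close> vanish at the ends, and the
  orthogonality to the rotation gives them a common total \<open>S = h \<Sum>\<^sub>j C j = h \<Sum>\<^sub>i D i\<close>. With a
  discrete parabola \<open>w\<close> that vanishes at both ends and satisfies \<open>h \<Sum>\<^sub>i w i = 1\<close>, the choice
  \<open>c i j = C j * w i + D i * w j - S * w i * w j\<close> has the required sums (lemma \<open>shear_stress\<close>).
  The numbers \<open>C\<close>, \<open>D\<close>, \<open>S\<close> are bounded by the L1 norm of \<open>v\<close>, the difference quotients of \<open>C\<close>
  and \<open>D\<close> are averages of the load over a row or column, and \<open>w\<close> and its difference quotients are
  bounded uniformly in \<open>N\<close>; this gives the estimate.
\<close>

section \<open>The difference equations on the degrees of freedom\<close>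

lemma sum_partial_sums:
  fixes F :: "nat \<Rightarrow> real"
  shows "(\<Sum>j<n. \<Sum>k<j. F k) = real n * (\<Sum>k<n. F k) - (\<Sum>k<n. (real k + 1) * F k)"
  by (induction n) (simp_all add: algebra_simps)

text \<open>
  The profile used to spread a prescribed row or column sum over the vertices: a discrete
  parabola that vanishes at both ends, has mean value 1 over the first \<open>N\<close> points if \<open>N \<ge> 2\<close>, and
  whose values and difference quotients are then bounded independently of \<open>N\<close>. A constant profile would have
  difference quotients of order \<open>N\<close> next to the boundary.
\<close>

definition weight :: "nat \<Rightarrow> nat \<Rightarrow> real" where
  "weight N i = 6 * real i * (real N - real i) / ((real N)\<^sup>2 - 1)"

lemma weight_0 [simp]: "weight N 0 = 0" and weight_N [simp]: "weight N N = 0"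
  by (simp_all add: weight_def)

lemma sum_weight:
  assumes "2 \<le> N"
  shows "(\<Sum>i<N. weight N i) = N"
proof -
  have *: "(\<Sum>i<n. real i * (x - real i)) = real n * (real n - 1) * (3 * x - 2 * real n + 1) / 6" for n x
    by (induction n) (simp_all add: field_simps)
  have "(\<Sum>i<N. weight N i) = 6 * (\<Sum>i<N. real i * (real N - real i)) / ((real N)\<^sup>2 - 1)"
    by (simp add: weight_def sum_distrib_left sum_divide_distrib mult.assoc)
  also have "(\<Sum>i<N. real i * (real N - real i)) = real N * ((real N)\<^sup>2 - 1) / 6"
    unfolding * by (simp add: algebra_simps power2_eq_square)
  finally show ?thesis
    using assms by (simp add: power2_eq_1_iff)
qed

lemma weight_bound:
  assumes "2 \<le> N" "i \<le> N"
  shows "\<bar>weight N i\<bar> \<le> 2"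
proof -
  define n where "n = real N"
  have n: "n \<ge> 2" "real i \<le> n" using assms by (auto simp: n_def)
  have n4: "n\<^sup>2 \<ge> 4" using power_mono[of 2 n 2] n by simp
  have "0 \<le> (n - 2 * real i)\<^sup>2" by simp
  then have "4 * (real i * (n - real i)) \<le> n\<^sup>2" by (simp add: power2_eq_square algebra_simps)
  then have "6 * real i * (n - real i) \<le> 2 * (n\<^sup>2 - 1)" using n4 by simp
  moreover have "0 \<le> 6 * real i * (n - real i)" using n by simp
  ultimately show ?thesis using n4 unfolding weight_def n_def by (simp add: field_simps)
qed

lemma weight_diff_bound:
  assumes "2 \<le> N" "i < N"
  shows "\<bar>real N * (weight N (Suc i) - weight N i)\<bar> \<le> 6"
proof -
  define n where "n = real N"
  have n: "n \<ge> 2" "real i + 1 \<le> n" using assms by (auto simp: n_def)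
  have n4: "n\<^sup>2 \<ge> 4" using power_mono[of 2 n 2] n by simp
  have eq: "real N * (weight N (Suc i) - weight N i) = 6 * (n * (n - 2 * real i - 1)) / (n\<^sup>2 - 1)"
    unfolding weight_def n_def by (simp add: diff_divide_distrib [symmetric]) (simp add: algebra_simps)
  have "\<bar>n * (n - 2 * real i - 1)\<bar> = n * \<bar>n - 2 * real i - 1\<bar>" using n by (simp add: abs_mult)
  also have "\<dots> \<le> n * (n - 1)" using n by (intro mult_left_mono) auto
  also have "\<dots> \<le> n\<^sup>2 - 1" using n by (simp add: power2_eq_square algebra_simps)
  finally have "\<bar>n * (n - 2 * real i - 1)\<bar> \<le> n\<^sup>2 - 1" .
  then show ?thesis unfolding eq using n4 by (simp add: abs_mult field_simps)
qed

lemma abs_mean_le_mean_abs: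
  fixes x :: "nat \<Rightarrow> real"
  assumes "m \<le> n"
  shows "\<bar>(\<Sum>k<m. x k) / n\<bar> \<le> (\<Sum>k<n. \<bar>x k\<bar>) / n"
proof -
  have "\<bar>\<Sum>k<m. x k\<bar> \<le> (\<Sum>k<m. \<bar>x k\<bar>)" by (rule sum_abs)
  also have "\<dots> \<le> (\<Sum>k<n. \<bar>x k\<bar>)" using assms by (intro sum_mono2) auto
  finally show ?thesis by (simp add: divide_right_mono abs_divide)
qed

lemma mean_power2_le:
  fixes x :: "nat \<Rightarrow> real"
  shows "((\<Sum>k<n. x k) / n)\<^sup>2 \<le> (\<Sum>k<n. (x k)\<^sup>2) / n"
proof (cases "n = 0")
  case False
  have "(\<Sum>k<n. x k * 1)\<^sup>2 \<le> (\<Sum>k<n. (x k)\<^sup>2) * (\<Sum>k<n. 1\<^sup>2)"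
    by (rule Cauchy_Schwarz_ineq_sum)
  then show ?thesis using False by (simp add: power_divide power2_eq_square field_simps)
qed simp

text \<open>
  The first equilibrium equation, solved for the normal stress by summation along each row.
  The row condition says that the total load on every row is balanced by the shear stress, so
  that the sum also vanishes at the right end. The bound \<open>R\<close> on the vertical difference
  quotients of \<open>c\<close> enters the estimate without any further power of \<open>N\<close>.
  The second equilibrium equation is the same statement with rows and columns exchanged.
\<close>

lemma normal_stress_row:
  fixes f c :: "nat \<Rightarrow> nat \<Rightarrow> real"
  assumes N: "N > 0"
    and c0: "\<And>j. c 0 j = 0" and cN: "\<And>j. c N j = 0"
    and row: "\<And>j. j < N \<Longrightarrow> (\<Sum>i<N. c i (Suc j)) - (\<Sum>i<N. c i j) = (\<Sum>i<N. f i j) / N"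
    and bnd: "\<And>i j. i \<le> N \<Longrightarrow> j < N \<Longrightarrow> \<bar>real N * (c i (Suc j) - c i j)\<bar> \<le> R j"
  obtains a where "\<And>j. a 0 j = 0" "\<And>j. j < N \<Longrightarrow> a N j = 0"
    "\<And>i j. i < N \<Longrightarrow> j < N \<Longrightarrow> real N * (a (Suc i) j - a i j)
        + real N * (c i (Suc j) + c (Suc i) (Suc j) - c i j - c (Suc i) j) / 2 = f i j"
    "\<And>i j. i \<le> N \<Longrightarrow> j < N \<Longrightarrow> \<bar>a i j\<bar> \<le> (\<Sum>k<N. \<bar>f k j\<bar>) / N + R j"
proof -
  define d where "d i j = real N * (c i (Suc j) + c (Suc i) (Suc j) - c i j - c (Suc i) j) / 2" for i j
  define a where "a i j = (\<Sum>k<i. f k j - d k j) / N" for i j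
  have sh: "(\<Sum>i<N. c (Suc i) j) = (\<Sum>i<N. c i j)" for j
    using sum.lessThan_Suc_shift[of "\<lambda>i. c i j" N] by (simp add: c0 cN)
  have "(\<Sum>k<N. f k j - d k j) = 0" if "j < N" for j
  proof -
    have "(\<Sum>k<N. d k j) = real N * ((\<Sum>i<N. c i (Suc j)) - (\<Sum>i<N. c i j))"
      unfolding d_def by (simp add: sum_divide_distrib[symmetric] sum_distrib_left[symmetric]
          sum.distrib sum_subtractf sh)
    also have "\<dots> = (\<Sum>i<N. f i j)" using row[OF that] N by simp
    finally show ?thesis by (simp add: sum_subtractf)
  qed
  then have "a N j = 0" if "j < N" for j using that by (simp add: a_def)
  moreover have "real N * (a (Suc i) j - a i j) + d i j = f i j" for i j
    using N by (simp add: a_def field_simps)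
  moreover have "\<bar>a i j\<bar> \<le> (\<Sum>k<N. \<bar>f k j\<bar>) / N + R j" if "i \<le> N" "j < N" for i j
  proof -
    have "\<bar>d k j\<bar> \<le> R j" if "k < N" for k
    proof -
      have "d k j = (real N * (c k (Suc j) - c k j) + real N * (c (Suc k) (Suc j) - c (Suc k) j)) / 2"
        by (simp add: d_def algebra_simps)
      then show ?thesis using bnd[of k j] bnd[of "Suc k" j] that \<open>j < N\<close> by auto
    qed
    then have "(\<Sum>k<N. \<bar>f k j - d k j\<bar>) \<le> (\<Sum>k<N. \<bar>f k j\<bar> + R j)"
      by (intro sum_mono) (smt (verit) lessThan_iff)
    also have "\<dots> = (\<Sum>k<N. \<bar>f k j\<bar>) + N * R j" by (simp add: sum.distrib)
    finally have "(\<Sum>k<N. \<bar>f k j - d k j\<bar>) / N \<le> ((\<Sum>k<N. \<bar>f k j\<bar>) + N * R j) / N"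
      by (intro divide_right_mono) auto
    then show ?thesis unfolding a_def
      using abs_mean_le_mean_abs[OF \<open>i \<le> N\<close>, of "\<lambda>k. f k j - d k j"] N by (simp add: add_divide_distrib)
  qed
  ultimately show ?thesis using that[of a] by (simp add: a_def d_def)
qed

text \<open>
  Vertex values of a shear stress that vanishes on the boundary and balances prescribed total
  loads \<open>F\<close> on the rows and \<open>G\<close> on the columns. Their row and column sums have to be the
  partial sums of \<open>F\<close> and \<open>G\<close>. The totals of \<open>F\<close> and \<open>G\<close> vanish, hence so do these partial sums
  at the far end; the equality of the first moments says that the row sums and the column sums
  have the same total. This is necessary, as both totals add up all vertex values, and sufficient
  by the product formula for \<open>c\<close> in the proof.
\<close>

lemma shear_stress:
  fixes F G :: "nat \<Rightarrow> real"
  assumes N: "2 \<le> N"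
    and F0: "(\<Sum>j<N. F j) = 0" and G0: "(\<Sum>i<N. G i) = 0"
    and mom: "(\<Sum>j<N. real j * F j) = (\<Sum>i<N. real i * G i)"
    and FP: "(\<Sum>j<N. \<bar>F j\<bar>) / N \<le> P" and GP: "(\<Sum>i<N. \<bar>G i\<bar>) / N \<le> P"
  obtains c where "\<And>j. c 0 j = 0" "\<And>j. c N j = 0" "\<And>i. c i 0 = 0" "\<And>i. c i N = 0"
    "\<And>j. (\<Sum>i<N. c i (Suc j)) - (\<Sum>i<N. c i j) = F j"
    "\<And>i. (\<Sum>j<N. c (Suc i) j) - (\<Sum>j<N. c i j) = G i"
    "\<And>i j. i \<le> N \<Longrightarrow> j \<le> N \<Longrightarrow> \<bar>c i j\<bar> \<le> 8 * P"
    "\<And>i j. i \<le> N \<Longrightarrow> j < N \<Longrightarrow> \<bar>real N * (c i (Suc j) - c i j)\<bar> \<le> 2 * \<bar>F j\<bar> + 18 * P"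
    "\<And>i j. i < N \<Longrightarrow> j \<le> N \<Longrightarrow> \<bar>real N * (c (Suc i) j - c i j)\<bar> \<le> 2 * \<bar>G i\<bar> + 18 * P"
proof -
  define w where "w = weight N"
  define C where "C j = (\<Sum>k<j. F k) / N" for j
  define D where "D i = (\<Sum>k<i. G k) / N" for i
  define S where "S = (\<Sum>j<N. C j) / N"
  define c where "c i j = C j * w i + D i * w j - S * w i * w j" for i j
  have w0: "w 0 = 0" "w N = 0" by (simp_all add: w_def)
  have sw: "(\<Sum>i<N. w i) = N" unfolding w_def using N by (rule sum_weight)
  have CD0: "C 0 = 0" "D 0 = 0" "C N = 0" "D N = 0" by (simp_all add: C_def D_def F0 G0)
  have SC: "(\<Sum>j<N. C j) = N * S" using N by (simp add: S_def)
  have "(\<Sum>j<N. C j) = - (\<Sum>j<N. real j * F j) / N"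
    by (simp add: C_def sum_divide_distrib[symmetric] sum_partial_sums F0 distrib_right sum.distrib)
  moreover have "(\<Sum>j<N. D j) = - (\<Sum>j<N. real j * G j) / N"
    by (simp add: D_def sum_divide_distrib[symmetric] sum_partial_sums G0 distrib_right sum.distrib)
  ultimately have SD: "(\<Sum>i<N. D i) = N * S" using mom SC by simp
  \<comment> \<open>The last term of \<open>c\<close> cancels the row sums of the second one and the column sums of the first one.\<close>
  have rows: "(\<Sum>i<N. c i j) = N * C j" for j
  proof -
    have "(\<Sum>i<N. c i j) = C j * (\<Sum>i<N. w i) + (\<Sum>i<N. D i) * w j - S * (\<Sum>i<N. w i) * w j"
      by (simp add: c_def sum.distrib sum_subtractf sum_distrib_left sum_distrib_right)
    then show ?thesis by (simp add: sw SD)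
  qed
  have cols: "(\<Sum>j<N. c i j) = N * D i" for i
  proof -
    have "(\<Sum>j<N. c i j) = (\<Sum>j<N. C j) * w i + D i * (\<Sum>j<N. w j) - S * w i * (\<Sum>j<N. w j)"
      by (simp add: c_def sum.distrib sum_subtractf sum_distrib_left sum_distrib_right)
    then show ?thesis by (simp add: sw SC)
  qed
  have CS: "real N * (C (Suc j) - C j) = F j" and DS: "real N * (D (Suc j) - D j) = G j" for j
    using N by (simp_all add: C_def D_def field_simps)
  have CP: "\<bar>C j\<bar> \<le> P" if "j \<le> N" for j
    using abs_mean_le_mean_abs[OF that, of F] FP by (simp add: C_def)
  have DP: "\<bar>D j\<bar> \<le> P" if "j \<le> N" for j
    using abs_mean_le_mean_abs[OF that, of G] GP by (simp add: D_def)
  have SP: "\<bar>S\<bar> \<le> P"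
  proof -
    have "(\<Sum>k<N. \<bar>C k\<bar>) / N \<le> (\<Sum>k<N. P) / N"
      by (intro divide_right_mono sum_mono CP) auto
    then show ?thesis using abs_mean_le_mean_abs[of N N C, OF order_refl] N by (simp add: S_def)
  qed
  have P: "P \<ge> 0" using SP by linarith
  have wb: "\<bar>w i\<bar> \<le> 2" if "i \<le> N" for i unfolding w_def using N that by (rule weight_bound)
  have dwb: "\<bar>real N * (w (Suc i) - w i)\<bar> \<le> 6" if "i < N" for i
    unfolding w_def using N that by (rule weight_diff_bound)
  have m: "\<bar>x * y\<bar> \<le> X * Y" if "\<bar>x\<bar> \<le> X" "\<bar>y\<bar> \<le> Y" for x y X Y :: real
    unfolding abs_mult using that by (intro mult_mono) auto
  show ?thesis
  proof (rule that[of c])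
    show "(\<Sum>i<N. c i (Suc j)) - (\<Sum>i<N. c i j) = F j" for j
      using CS[of j] by (simp add: rows algebra_simps)
    show "(\<Sum>j<N. c (Suc i) j) - (\<Sum>j<N. c i j) = G i" for i
      using DS[of i] by (simp add: cols algebra_simps)
  next
    fix i j assume ij: "i \<le> N" "j \<le> N"
    show "\<bar>c i j\<bar> \<le> 8 * P"
      using m[OF CP wb, OF ij(2,1)] m[OF DP wb, OF ij] m[OF m[OF SP wb] wb, OF ij]
      unfolding c_def by linarith
  next
    fix i j assume ij: "i \<le> N" "j < N"
    have eq: "real N * (c i (Suc j) - c i j)
      = F j * w i + D i * (real N * (w (Suc j) - w j)) - S * w i * (real N * (w (Suc j) - w j))"
      unfolding c_def CS[symmetric] by (simp add: algebra_simps)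
    show "\<bar>real N * (c i (Suc j) - c i j)\<bar> \<le> 2 * \<bar>F j\<bar> + 18 * P"
      using m[OF order_refl wb, of i "F j"] m[OF DP dwb, OF ij] m[OF m[OF SP wb] dwb, OF ij] ij
      unfolding eq by linarith
  next
    fix i j assume ij: "i < N" "j \<le> N"
    have eq: "real N * (c (Suc i) j - c i j)
      = G i * w j + C j * (real N * (w (Suc i) - w i)) - S * w j * (real N * (w (Suc i) - w i))"
      unfolding c_def DS[symmetric] by (simp add: algebra_simps)
    show "\<bar>real N * (c (Suc i) j - c i j)\<bar> \<le> 2 * \<bar>G i\<bar> + 18 * P"
      using m[OF order_refl wb, of j "G i"] m[OF CP dwb, OF ij(2,1)] m[OF m[OF SP wb] dwb, OF ij(2,1)] ij
      unfolding eq by linarith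
  qed (simp_all add: c_def w0 CD0)
qed

text \<open>
  Vertical edges carry the values \<open>a\<close> of the first normal stress, horizontal edges the values
  \<open>b\<close> of the second one, and vertices the values \<open>c\<close> that generate the shear stress. The two
  equations state that the divergence of this stress is \<open>(f, g)\<close> on every cell. The three
  hypotheses on \<open>(f, g)\<close> are orthogonality to the rigid motions, and \<open>P\<close> is the L1 norm of
  \<open>(f, g)\<close>.
\<close>

lemma discrete_right_inverse:
  fixes f g :: "nat \<Rightarrow> nat \<Rightarrow> real"
  assumes N: "N \<ge> 1"
    and f0: "(\<Sum>i<N. \<Sum>j<N. f i j) = 0" and g0: "(\<Sum>i<N. \<Sum>j<N. g i j) = 0"
    and mom: "(\<Sum>i<N. \<Sum>j<N. real j * f i j) = (\<Sum>i<N. \<Sum>j<N. real i * g i j)"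
  defines "P \<equiv> (\<Sum>i<N. \<Sum>j<N. \<bar>f i j\<bar> + \<bar>g i j\<bar>) / (real N)\<^sup>2"
  obtains a b c where "\<And>j. a 0 j = 0" "\<And>j. j < N \<Longrightarrow> a N j = 0"
    "\<And>i. b i 0 = 0" "\<And>i. i < N \<Longrightarrow> b i N = 0"
    "\<And>j. c 0 j = 0" "\<And>j. c N j = 0" "\<And>i. c i 0 = 0" "\<And>i. c i N = 0"
    "\<And>i j. i < N \<Longrightarrow> j < N \<Longrightarrow> real N * (a (Suc i) j - a i j)
        + real N * (c i (Suc j) + c (Suc i) (Suc j) - c i j - c (Suc i) j) / 2 = f i j"
    "\<And>i j. i < N \<Longrightarrow> j < N \<Longrightarrow> real N * (b i (Suc j) - b i j)
        + real N * (c (Suc i) j + c (Suc i) (Suc j) - c i j - c i (Suc j)) / 2 = g i j"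
    "\<And>i j. i \<le> N \<Longrightarrow> j < N \<Longrightarrow> \<bar>a i j\<bar> \<le> 3 * ((\<Sum>k<N. \<bar>f k j\<bar>) / N) + 18 * P"
    "\<And>i j. i < N \<Longrightarrow> j \<le> N \<Longrightarrow> \<bar>b i j\<bar> \<le> 3 * ((\<Sum>k<N. \<bar>g i k\<bar>) / N) + 18 * P"
    "\<And>i j. i \<le> N \<Longrightarrow> j \<le> N \<Longrightarrow> \<bar>c i j\<bar> \<le> 8 * P"
proof (cases "N = 1")
  \<comment> \<open>On a single cell the load is zero; the weights, whose mean is 1 only for at least two cells per row, are not used.\<close>
  case True
  then show ?thesis using that[of "\<lambda>_ _. 0" "\<lambda>_ _. 0" "\<lambda>_ _. 0"] f0 g0 by (simp add: P_def)
next
  case False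
  then have N2: "2 \<le> N" and N0: "N > 0" using N by simp_all
  define F where "F j = (\<Sum>i<N. f i j) / N" for j
  define G where "G i = (\<Sum>j<N. g i j) / N" for i
  have absF: "\<bar>F j\<bar> \<le> (\<Sum>k<N. \<bar>f k j\<bar>) / N" for j
    unfolding F_def by (rule abs_mean_le_mean_abs) simp
  have absG: "\<bar>G i\<bar> \<le> (\<Sum>k<N. \<bar>g i k\<bar>) / N" for i
    unfolding G_def by (rule abs_mean_le_mean_abs) simp
  have F0: "(\<Sum>j<N. F j) = 0"
    unfolding F_def sum_divide_distrib[symmetric] by (subst sum.swap) (simp add: f0)
  have G0: "(\<Sum>i<N. G i) = 0"
    unfolding G_def sum_divide_distrib[symmetric] by (simp add: g0)
  have "(\<Sum>j<N. real j * F j) = (\<Sum>j<N. \<Sum>i<N. real j * f i j) / N"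
    by (simp add: F_def sum_divide_distrib sum_distrib_left)
  also have "\<dots> = (\<Sum>i<N. \<Sum>j<N. real j * f i j) / N" by (subst sum.swap) simp
  also have "\<dots> = (\<Sum>i<N. real i * G i)"
    unfolding mom by (simp add: G_def sum_divide_distrib sum_distrib_left)
  finally have mom': "(\<Sum>j<N. real j * F j) = (\<Sum>i<N. real i * G i)" .
  have "(\<Sum>j<N. \<bar>F j\<bar>) / N \<le> (\<Sum>j<N. (\<Sum>k<N. \<bar>f k j\<bar>) / N) / N"
    by (intro divide_right_mono sum_mono absF) auto
  also have "\<dots> = (\<Sum>k<N. \<Sum>j<N. \<bar>f k j\<bar>) / (real N)\<^sup>2"
    using sum.swap[of "\<lambda>k j. \<bar>f k j\<bar>" "{..<N}" "{..<N}"]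
    by (simp add: sum_divide_distrib[symmetric] power2_eq_square)
  also have "\<dots> \<le> P" unfolding P_def by (intro divide_right_mono sum_mono) auto
  finally have FP: "(\<Sum>j<N. \<bar>F j\<bar>) / N \<le> P" .
  have "(\<Sum>i<N. \<bar>G i\<bar>) / N \<le> (\<Sum>i<N. (\<Sum>k<N. \<bar>g i k\<bar>) / N) / N"
    by (intro divide_right_mono sum_mono absG) auto
  also have "\<dots> = (\<Sum>k<N. \<Sum>j<N. \<bar>g k j\<bar>) / (real N)\<^sup>2"
    by (simp add: sum_divide_distrib power2_eq_square)
  also have "\<dots> \<le> P" unfolding P_def by (intro divide_right_mono sum_mono) auto
  finally have GP: "(\<Sum>i<N. \<bar>G i\<bar>) / N \<le> P" .
  obtain c where c: "\<And>j. c 0 j = 0" "\<And>j. c N j = 0" "\<And>i. c i 0 = 0" "\<And>i. c i N = 0"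
    "\<And>j. (\<Sum>i<N. c i (Suc j)) - (\<Sum>i<N. c i j) = F j"
    "\<And>i. (\<Sum>j<N. c (Suc i) j) - (\<Sum>j<N. c i j) = G i"
    "\<And>i j. i \<le> N \<Longrightarrow> j \<le> N \<Longrightarrow> \<bar>c i j\<bar> \<le> 8 * P"
    "\<And>i j. i \<le> N \<Longrightarrow> j < N \<Longrightarrow> \<bar>real N * (c i (Suc j) - c i j)\<bar> \<le> 2 * \<bar>F j\<bar> + 18 * P"
    "\<And>i j. i < N \<Longrightarrow> j \<le> N \<Longrightarrow> \<bar>real N * (c (Suc i) j - c i j)\<bar> \<le> 2 * \<bar>G i\<bar> + 18 * P"
    by (rule shear_stress[OF N2 F0 G0 mom' FP GP], rule that)
  obtain a where a: "\<And>j. a 0 j = 0" "\<And>j. j < N \<Longrightarrow> a N j = 0"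
    "\<And>i j. i < N \<Longrightarrow> j < N \<Longrightarrow> real N * (a (Suc i) j - a i j)
        + real N * (c i (Suc j) + c (Suc i) (Suc j) - c i j - c (Suc i) j) / 2 = f i j"
    "\<And>i j. i \<le> N \<Longrightarrow> j < N \<Longrightarrow> \<bar>a i j\<bar> \<le> (\<Sum>k<N. \<bar>f k j\<bar>) / N + (2 * \<bar>F j\<bar> + 18 * P)"
  proof (rule normal_stress_row[where N = N and c = c and f = f and R = "\<lambda>j. 2 * \<bar>F j\<bar> + 18 * P"])
    show "(\<Sum>i<N. c i (Suc j)) - (\<Sum>i<N. c i j) = (\<Sum>i<N. f i j) / real N" for j
      using c(5) by (simp add: F_def)
  qed (use N0 c that in blast)+
  obtain b where b: "\<And>i. b 0 i = 0" "\<And>i. i < N \<Longrightarrow> b N i = 0"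
    "\<And>j i. j < N \<Longrightarrow> i < N \<Longrightarrow> real N * (b (Suc j) i - b j i)
        + real N * (c (Suc i) j + c (Suc i) (Suc j) - c i j - c i (Suc j)) / 2 = g i j"
    "\<And>j i. j \<le> N \<Longrightarrow> i < N \<Longrightarrow> \<bar>b j i\<bar> \<le> (\<Sum>k<N. \<bar>g i k\<bar>) / N + (2 * \<bar>G i\<bar> + 18 * P)"
  proof (rule normal_stress_row[where N = N and c = "\<lambda>j i. c i j" and f = "\<lambda>j i. g i j"
        and R = "\<lambda>i. 2 * \<bar>G i\<bar> + 18 * P"])
    show "(\<Sum>j<N. c (Suc i) j) - (\<Sum>j<N. c i j) = (\<Sum>j<N. g i j) / real N" for i
      using c(6) by (simp add: G_def)
  qed (use N0 c that in blast)+
  show ?thesis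
  proof (rule that[of a "\<lambda>i j. b j i" c])
    show "\<bar>a i j\<bar> \<le> 3 * ((\<Sum>k<N. \<bar>f k j\<bar>) / N) + 18 * P" if "i \<le> N" "j < N" for i j
      using a(4)[OF that] absF[of j] by linarith
    show "\<bar>b j i\<bar> \<le> 3 * ((\<Sum>k<N. \<bar>g i k\<bar>) / N) + 18 * P" if "i < N" "j \<le> N" for i j
      using b(4)[OF that(2,1)] absG[of i] by linarith
  qed (simp_all add: a b c)
qed

text \<open>
  The pointwise bounds of the preceding lemma, squared and averaged over the cells, are
  controlled by the L2 norm of \<open>(f, g)\<close>. The constant 32 is four times the bound 8 for the vertex
  values, since a shear stress is bounded on a cell by four times its largest vertex value.
\<close>

lemma discrete_energy_bound:
  fixes f g :: "nat \<Rightarrow> nat \<Rightarrow> real"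
  assumes N: "N \<ge> 1"
  defines "P \<equiv> (\<Sum>i<N. \<Sum>j<N. \<bar>f i j\<bar> + \<bar>g i j\<bar>) / (real N)\<^sup>2"
    and "A \<equiv> \<lambda>j. (\<Sum>k<N. \<bar>f k j\<bar>) / N" and "B \<equiv> \<lambda>i. (\<Sum>k<N. \<bar>g i k\<bar>) / N"
  shows "(\<Sum>i<N. \<Sum>j<N. (3 * A j + 18 * P)\<^sup>2 + (3 * B i + 18 * P)\<^sup>2 + 2 * (32 * P)\<^sup>2) / (real N)\<^sup>2
    \<le> 9999 * ((\<Sum>i<N. \<Sum>j<N. (f i j)\<^sup>2 + (g i j)\<^sup>2) / (real N)\<^sup>2)"
proof -
  define L where "L = (\<Sum>i<N. \<Sum>j<N. (f i j)\<^sup>2 + (g i j)\<^sup>2) / (real N)\<^sup>2"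
  have two: "(x + y)\<^sup>2 \<le> 2 * x\<^sup>2 + 2 * y\<^sup>2" for x y :: real
    using sum_squares_bound[of x y] by (simp add: power2_sum)
  have A: "(A j)\<^sup>2 \<le> (\<Sum>k<N. (f k j)\<^sup>2) / N" for j
    using mean_power2_le[of "\<lambda>k. \<bar>f k j\<bar>" N] by (simp add: A_def)
  have B: "(B i)\<^sup>2 \<le> (\<Sum>k<N. (g i k)\<^sup>2) / N" for i
    using mean_power2_le[of "\<lambda>k. \<bar>g i k\<bar>" N] by (simp add: B_def)
  have "P = (\<Sum>i<N. (\<Sum>j<N. \<bar>f i j\<bar> + \<bar>g i j\<bar>) / N) / N"
    by (simp add: P_def sum_divide_distrib[symmetric] power2_eq_square)
  then have "P\<^sup>2 \<le> (\<Sum>i<N. ((\<Sum>j<N. \<bar>f i j\<bar> + \<bar>g i j\<bar>) / N)\<^sup>2) / N"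
    using mean_power2_le by simp
  also have "\<dots> \<le> (\<Sum>i<N. (\<Sum>j<N. (\<bar>f i j\<bar> + \<bar>g i j\<bar>)\<^sup>2) / N) / N"
    by (intro divide_right_mono sum_mono mean_power2_le) auto
  also have "\<dots> \<le> (\<Sum>i<N. (\<Sum>j<N. 2 * (f i j)\<^sup>2 + 2 * (g i j)\<^sup>2) / N) / N"
    using two by (intro divide_right_mono sum_mono) (auto simp: abs_le_square_iff intro: order_trans[OF two])
  also have "\<dots> = 2 * L"
    by (simp add: L_def sum_divide_distrib[symmetric] power2_eq_square sum_distrib_left distrib_left)
  finally have P: "P\<^sup>2 \<le> 2 * L" .
  have "(\<Sum>i<N. \<Sum>j<N. (3 * A j + 18 * P)\<^sup>2 + (3 * B i + 18 * P)\<^sup>2 + 2 * (32 * P)\<^sup>2)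
    \<le> (\<Sum>i<N. \<Sum>j<N. 18 * ((\<Sum>k<N. (f k j)\<^sup>2) / N) + 18 * ((\<Sum>k<N. (g i k)\<^sup>2) / N) + 6688 * L)"
  proof (intro sum_mono)
    fix i j
    show "(3 * A j + 18 * P)\<^sup>2 + (3 * B i + 18 * P)\<^sup>2 + 2 * (32 * P)\<^sup>2
      \<le> 18 * ((\<Sum>k<N. (f k j)\<^sup>2) / N) + 18 * ((\<Sum>k<N. (g i k)\<^sup>2) / N) + 6688 * L"
      using two[of "3 * A j" "18 * P"] two[of "3 * B i" "18 * P"] A[of j] B[of i] P
      unfolding power_mult_distrib by simp
  qed
  also have "\<dots> = 18 * (\<Sum>j<N. \<Sum>k<N. (f k j)\<^sup>2) + 18 * (\<Sum>i<N. \<Sum>k<N. (g i k)\<^sup>2) + 6688 * ((real N)\<^sup>2 * L)"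
    using N by (simp add: sum.distrib sum_distrib_left[symmetric] sum_divide_distrib[symmetric]
        power2_eq_square)
  also have "(\<Sum>j<N. \<Sum>k<N. (f k j)\<^sup>2) = (\<Sum>k<N. \<Sum>j<N. (f k j)\<^sup>2)" by (rule sum.swap)
  also have "18 * (\<Sum>k<N. \<Sum>j<N. (f k j)\<^sup>2) + 18 * (\<Sum>i<N. \<Sum>k<N. (g i k)\<^sup>2) = 18 * ((real N)\<^sup>2 * L)"
    using N by (simp add: L_def sum.distrib)
  also have "18 * ((real N)\<^sup>2 * L) + 6688 * ((real N)\<^sup>2 * L) \<le> 9999 * L * (real N)\<^sup>2"
    by (simp add: L_def sum_nonneg)
  finally show ?thesis using N by (simp add: L_def[symmetric] divide_le_eq)
qed

section \<open>Cells of the grid and integrals of piecewise affine functions\<close>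

text \<open>
  The open cell in column \<open>i\<close> and row \<open>j\<close> of the grid, counted from 0.
\<close>

definition cell :: "nat \<Rightarrow> nat \<Rightarrow> nat \<Rightarrow> (real^2) set" where
  "cell N i j = box (pt (real i / real N) (real j / real N))
                    (pt (real (i + 1) / real N) (real (j + 1) / real N))"

text \<open>
  The corresponding closed cell, an element of the mesh.
\<close>

definition closed_cell :: "nat \<Rightarrow> nat \<Rightarrow> nat \<Rightarrow> (real^2) set" where
  "closed_cell N i j = cbox (pt (real i / real N) (real j / real N))
                      (pt (real (i + 1) / real N) (real (j + 1) / real N))"

lemma mem_cell: "N > 0 \<Longrightarrow> x \<in> cell N i j \<longleftrightarrow>
    real i < real N * x$1 \<and> real N * x$1 < real i + 1 \<and>
    real j < real N * x$2 \<and> real N * x$2 < real j + 1"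
  by (auto simp: cell_def mem_box_cart forall_2 field_simps)

lemma mem_closed_cell: "N > 0 \<Longrightarrow> x \<in> closed_cell N i j \<longleftrightarrow>
    real i \<le> real N * x$1 \<and> real N * x$1 \<le> real i + 1 \<and>
    real j \<le> real N * x$2 \<and> real N * x$2 \<le> real j + 1"
  by (auto simp: closed_cell_def mem_box_cart forall_2 field_simps)

lemma mem_Om: "x \<in> Om \<longleftrightarrow> 0 < x$1 \<and> x$1 < 1 \<and> 0 < x$2 \<and> x$2 < 1"
  by (auto simp: Om_def mem_box_cart forall_2)

lemma open_Om: "open Om"
  unfolding Om_def by (rule open_box)

lemma Om_sets: "Om \<inter> space lebesgue \<in> sets lebesgue"
  using open_Om by simp

lemma mesh_eq: "mesh N = {closed_cell N i j | i j. i < N \<and> j < N}"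
  by (simp add: mesh_def closed_cell_def)

lemma interior_closed_cell: "interior (closed_cell N i j) = cell N i j"
  by (simp add: cell_def closed_cell_def)

lemma open_cell: "open (cell N i j)"
  unfolding cell_def by (rule open_box)

lemma cell_unique:
  assumes "N > 0" "x \<in> cell N i j" "x \<in> cell N i' j'"
  shows "i = i'" "j = j'"
  using assms by (auto simp: mem_cell)

lemma cell_subset_Om:
  assumes "i < N" "j < N"
  shows "cell N i j \<subseteq> Om"
proof
  fix x assume x: "x \<in> cell N i j"
  have N: "N > 0" using assms by simp
  have "real i + 1 \<le> N" "real j + 1 \<le> N" using assms by linarith+
  then have "0 < real N * x$1" "real N * x$1 < N" "0 < real N * x$2" "real N * x$2 < N"
    using x unfolding mem_cell[OF N] by linarith+
  then show "x \<in> Om" using N by (simp add: mem_Om zero_less_mult_iff)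
qed

lemma Om_cases:
  assumes N: "N > 0" and x: "x \<in> Om"
    and off: "\<And>k. k \<le> N \<Longrightarrow> x$1 \<noteq> real k / N" "\<And>k. k \<le> N \<Longrightarrow> x$2 \<noteq> real k / N"
  obtains i j where "i < N" "j < N" "x \<in> cell N i j"
proof -
  have *: "\<exists>i<N. real i < real N * t \<and> real N * t < real i + 1"
    if t: "0 < t" "t < 1" and ne: "\<And>k. k \<le> N \<Longrightarrow> t \<noteq> real k / N" for t
  proof -
    define i where "i = nat \<lfloor>real N * t\<rfloor>"
    have pos: "0 < real N * t" "real N * t < N" using N t by auto
    have i: "real i \<le> real N * t" "real N * t < real i + 1" unfolding i_def using pos by linarith+
    have "i < N" using i pos by linarith
    moreover have "real i \<noteq> real N * t" using ne[of i] \<open>i < N\<close> N by (auto simp: field_simps)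
    ultimately show ?thesis using i by (intro exI[of _ i]) auto
  qed
  obtain i where "i < N" "real i < real N * x$1" "real N * x$1 < real i + 1"
    using *[of "x$1"] x off by (auto simp: mem_Om)
  moreover obtain j where "j < N" "real j < real N * x$2" "real N * x$2 < real j + 1"
    using *[of "x$2"] x off by (auto simp: mem_Om)
  ultimately show ?thesis using that N by (auto simp: mem_cell)
qed

lemma AE_Om_in_cell:
  assumes N: "N > 0"
  shows "AE x in lebesgue_on Om. \<exists>i<N. \<exists>j<N. x \<in> cell N i j"
proof -
  define Z where "Z = (\<Union>k\<le>N. {x::real^2. x$1 = real k / N} \<union> {x. x$2 = real k / N})"
  have plane: "negligible {x::real^2. x$m = t}" for m t
    using negligible_standard_hyperplane[of "axis m 1 :: real^2" t]
    by (simp add: cart_eq_inner_axis axis_in_Basis_iff)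
  then have "negligible Z"
    unfolding Z_def by (intro negligible_Union) (auto intro!: negligible_Un plane)
  then have "Z \<in> null_sets lebesgue" by (simp add: negligible_iff_null_sets)
  then have "AE x in lebesgue. x \<notin> Z" by (rule AE_not_in)
  then have "AE x in lebesgue. x \<in> Om \<longrightarrow> (\<exists>i<N. \<exists>j<N. x \<in> cell N i j)"
  proof (rule eventually_mono, intro impI)
    fix x assume "x \<notin> Z" "x \<in> Om"
    then show "\<exists>i<N. \<exists>j<N. x \<in> cell N i j" by (rule_tac Om_cases[OF N, of x]) (auto simp: Z_def)
  qed
  then show ?thesis by (subst AE_restrict_space_iff) (auto simp: Om_def)
qed

lemma has_integral_cell_affine:
  assumes N: "N > 0"
  shows "((\<lambda>x::real^2. \<alpha> + \<beta> * x$1 + \<gamma> * x$2) has_integral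
    (\<alpha> + \<beta> * ((real i + 1/2) / N) + \<gamma> * ((real j + 1/2) / N)) / (real N)\<^sup>2) (closed_cell N i j)"
proof -
  define p q where "p = pt (real i / real N) (real j / real N)"
    and "q = pt (real (i + 1) / real N) (real (j + 1) / real N)"
  define \<phi> where "\<phi> = (\<lambda>x::real^2. \<alpha> + \<beta> * x$1 + \<gamma> * x$2)"
  have K: "closed_cell N i j = cbox p q" by (simp add: closed_cell_def p_def q_def)
  have cont: "continuous_on (cbox p q) \<phi>" unfolding \<phi>_def by (intro continuous_intros)
  then have "\<phi> integrable_on cbox p q" by (rule integrable_continuous)
  then obtain I where I: "(\<phi> has_integral I) (cbox p q)" by (auto simp: integrable_on_def)
  \<comment> \<open>The point reflection in the centre maps the cell to itself, and the sum of an affine function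
    and its reflection is constant.\<close>
  have "((\<lambda>x. \<phi> ((-1) *\<^sub>R x + (p + q))) has_integral (1 / (\<bar>-1\<bar> ^ DIM(real^2))) *\<^sub>R I)
      ((\<lambda>x. (1 / (-1)) *\<^sub>R x + - ((1 / (-1)) *\<^sub>R (p + q))) ` cbox p q)"
    by (rule has_integral_affinity[OF I]) simp
  moreover have "(\<lambda>x. (1 / (-1)) *\<^sub>R x + - ((1 / (-1)) *\<^sub>R (p + q))) ` cbox p q = cbox p q"
  proof -
    have "(\<lambda>x. (1 / (-1)) *\<^sub>R x + - ((1 / (-1)) *\<^sub>R (p + q))) = (\<lambda>x. (-1) *\<^sub>R x + (p + q))" by auto
    moreover have "p \<in> cbox p q" using N by (simp add: mem_box_cart forall_2 p_def q_def divide_right_mono)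
    ultimately show ?thesis using image_affinity_cbox[of "-1" "p + q" p q] by auto
  qed
  ultimately have "((\<lambda>x. \<phi> (p + q - x)) has_integral I) (cbox p q)" by simp
  then have "((\<lambda>x. \<phi> x + \<phi> (p + q - x)) has_integral I + I) (cbox p q)" by (rule has_integral_add[OF I])
  moreover have "(\<lambda>x. \<phi> x + \<phi> (p + q - x)) = (\<lambda>x. \<phi> (p + q) + \<alpha>)"
    by (auto simp: \<phi>_def algebra_simps)
  ultimately have "((\<lambda>x. \<phi> (p + q) + \<alpha>) has_integral I + I) (cbox p q)" by simp
  moreover have "((\<lambda>x. \<phi> (p + q) + \<alpha>) has_integral measure lborel (cbox p q) *\<^sub>R (\<phi> (p + q) + \<alpha>)) (cbox p q)"
    by (rule has_integral_const)
  ultimately have "I + I = measure lborel (cbox p q) *\<^sub>R (\<phi> (p + q) + \<alpha>)" by (rule has_integral_unique)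
  moreover have "measure lborel (cbox p q) = 1 / (real N)\<^sup>2"
  proof -
    have "cbox p q \<noteq> {}" using N by (simp add: interval_ne_empty_cart forall_2 p_def q_def divide_right_mono)
    then have "measure lborel (cbox p q) = (\<Prod>k\<in>UNIV. q$k - p$k)" by (rule content_cbox_cart)
    then show ?thesis by (simp add: UNIV_2 p_def q_def diff_divide_distrib[symmetric] power2_eq_square)
  qed
  ultimately have double: "I + I = (\<phi> (p + q) + \<alpha>) / (real N)\<^sup>2" by simp
  have "I = (I + I) / 2" by simp
  also note double
  also have "\<phi> (p + q) = \<alpha> + \<beta> * ((2 * real i + 1) / N) + \<gamma> * ((2 * real j + 1) / N)"
    by (simp add: \<phi>_def p_def q_def add_divide_distrib[symmetric])
  finally have "I = (\<alpha> + \<beta> * ((2 * real i + 1) / N) + \<gamma> * ((2 * real j + 1) / N) + \<alpha>) / (real N)\<^sup>2 / 2" .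
  also have "\<dots> = (\<alpha> + \<beta> * ((real i + 1/2) / N) + \<gamma> * ((real j + 1/2) / N)) / (real N)\<^sup>2"
    using N by (simp add: field_simps)
  finally have "I = (\<alpha> + \<beta> * ((real i + 1/2) / N) + \<gamma> * ((real j + 1/2) / N)) / (real N)\<^sup>2" .
  then show ?thesis using I unfolding K \<phi>_def by simp
qed

lemma has_bochner_integral_cell_affine:
  assumes N: "N > 0"
  shows "has_bochner_integral lebesgue (\<lambda>x::real^2. indicator (cell N i j) x * (\<alpha> + \<beta> * x$1 + \<gamma> * x$2))
    ((\<alpha> + \<beta> * ((real i + 1/2) / N) + \<gamma> * ((real j + 1/2) / N)) / (real N)\<^sup>2)"
proof -
  let ?\<phi> = "\<lambda>x::real^2. \<alpha> + \<beta> * x$1 + \<gamma> * x$2"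
  have "continuous_on (closed_cell N i j) ?\<phi>" by (intro continuous_intros)
  then have int: "?\<phi> absolutely_integrable_on closed_cell N i j"
    unfolding closed_cell_def by (rule absolutely_integrable_continuous)
  have sub: "cell N i j \<subseteq> closed_cell N i j" unfolding cell_def closed_cell_def by (rule box_subset_cbox)
  have abs: "?\<phi> absolutely_integrable_on cell N i j"
    by (rule set_integrable_subset[OF int _ sub]) (use open_cell in simp)
  have "(?\<phi> has_integral (\<alpha> + \<beta> * ((real i + 1/2) / N) + \<gamma> * ((real j + 1/2) / N)) / (real N)\<^sup>2) (cell N i j)"
    using has_integral_cell_affine[OF N] unfolding cell_def closed_cell_def by (simp add: has_integral_open_interval)
  then have "integral (cell N i j) ?\<phi> = (\<alpha> + \<beta> * ((real i + 1/2) / N) + \<gamma> * ((real j + 1/2) / N)) / (real N)\<^sup>2"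
    by (rule integral_unique)
  then show ?thesis using abs set_lebesgue_integral_eq_integral[OF abs]
    by (simp add: has_bochner_integral_iff set_integrable_def set_lebesgue_integral_def)
qed

text \<open>
  The function that is \<open>A i j\<close> on the open cell with indices \<open>i\<close> and \<open>j\<close>, and 0 on the grid lines
  and outside the square.
\<close>

definition glue :: "nat \<Rightarrow> (nat \<Rightarrow> nat \<Rightarrow> real^2 \<Rightarrow> 'a) \<Rightarrow> real^2 \<Rightarrow> 'a::real_vector" where
  "glue N A x = (\<Sum>i<N. \<Sum>j<N. indicator (cell N i j) x *\<^sub>R A i j x)"

lemma glue_on_cell:
  assumes "i < N" "j < N" "x \<in> cell N i j"
  shows "glue N A x = A i j x"
proof -
  have N: "N > 0" using assms by simp
  have "indicator (cell N i' j') x *\<^sub>R A i' j' x = (if j' = j then if i' = i then A i j x else 0 else 0)" for i' j'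
  proof (cases "i' = i \<and> j' = j")
    case True
    then show ?thesis using assms(3) by simp
  next
    case False
    then have "x \<notin> cell N i' j'" using cell_unique[OF N assms(3), of i' j'] by blast
    then show ?thesis using False by simp
  qed
  then show ?thesis using assms(1,2) by (simp add: glue_def)
qed

lemma measurable_glue:
  fixes A :: "nat \<Rightarrow> nat \<Rightarrow> real^2 \<Rightarrow> 'a::euclidean_space"
  assumes "\<And>i j. continuous_on UNIV (A i j)"
  shows "glue N A \<in> borel_measurable (lebesgue_on Om)"
proof -
  have "A i j \<in> borel_measurable lebesgue" for i j
    using assms by (intro measurable_completion) (simp add: borel_measurable_continuous_onI)
  moreover have "cell N i j \<in> sets lebesgue" for i j using open_cell by simp
  ultimately have "glue N A \<in> borel_measurable lebesgue"
    unfolding glue_def by (intro borel_measurable_sum borel_measurable_scaleR borel_measurable_indicator)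
  then show ?thesis by (rule measurable_restrict_space1)
qed

lemma has_bochner_integral_piecewise_affine:
  assumes N: "N > 0" and meas: "g \<in> borel_measurable (lebesgue_on Om)"
    and g: "\<And>i j x. i < N \<Longrightarrow> j < N \<Longrightarrow> x \<in> cell N i j \<Longrightarrow> g x = \<alpha> i j + \<beta> i j * x$1 + \<gamma> i j * x$2"
  shows "has_bochner_integral (lebesgue_on Om) g
    ((\<Sum>i<N. \<Sum>j<N. \<alpha> i j + \<beta> i j * ((real i + 1/2) / N) + \<gamma> i j * ((real j + 1/2) / N)) / (real N)\<^sup>2)"
proof -
  let ?A = "\<lambda>i j (x::real^2). \<alpha> i j + \<beta> i j * x$1 + \<gamma> i j * x$2"
  let ?s = "glue N ?A"
  have "has_bochner_integral lebesgue ?s (\<Sum>i<N. \<Sum>j<N.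
     (\<alpha> i j + \<beta> i j * ((real i + 1/2) / N) + \<gamma> i j * ((real j + 1/2) / N)) / (real N)\<^sup>2)"
    unfolding glue_def real_scaleR_def by (intro has_bochner_integral_sum has_bochner_integral_cell_affine N)
  moreover have "indicator Om x *\<^sub>R ?s x = ?s x" for x
  proof (cases "x \<in> Om")
    case False
    then have "indicator (cell N i j) x = (0::real)" if "i < N" "j < N" for i j
      using cell_subset_Om[OF that] by (auto simp: indicator_def)
    then show ?thesis using False by (simp add: glue_def)
  qed simp
  then have "(\<lambda>x. indicator Om x *\<^sub>R ?s x) = ?s" by (rule ext)
  ultimately have "has_bochner_integral (lebesgue_on Om) ?s (\<Sum>i<N. \<Sum>j<N.
     (\<alpha> i j + \<beta> i j * ((real i + 1/2) / N) + \<gamma> i j * ((real j + 1/2) / N)) / (real N)\<^sup>2)"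
    by (subst has_bochner_integral_restrict_space) (simp_all only: Om_sets)
  moreover have "AE x in lebesgue_on Om. ?s x = g x"
    using AE_Om_in_cell[OF N]
  proof (rule eventually_mono)
    fix x assume "\<exists>i<N. \<exists>j<N. x \<in> cell N i j"
    then obtain i j where "i < N" "j < N" "x \<in> cell N i j" by auto
    then show "?s x = g x" using g by (simp add: glue_on_cell)
  qed
  ultimately show ?thesis
    unfolding sum_divide_distrib by (rule has_bochner_integralI_AE[OF _ meas])
qed

lemma integral_piecewise_constant:
  assumes N: "N > 0" and meas: "g \<in> borel_measurable (lebesgue_on Om)"
    and g: "\<And>i j x. i < N \<Longrightarrow> j < N \<Longrightarrow> x \<in> cell N i j \<Longrightarrow> g x = G i j"
  shows "integrable (lebesgue_on Om) g"
    and "(LINT x|lebesgue_on Om. g x) = (\<Sum>i<N. \<Sum>j<N. G i j) / (real N)\<^sup>2"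
  using has_bochner_integral_piecewise_affine[OF N meas, of G "\<lambda>_ _. 0" "\<lambda>_ _. 0"] g
  by (auto simp: has_bochner_integral_iff)

section \<open>Piecewise affine stress fields\<close>

lemma L2_inner_self_le:
  assumes N: "N > 0" and meas: "\<sigma> \<in> borel_measurable (lebesgue_on Om)"
    and le: "\<And>i j x. i < N \<Longrightarrow> j < N \<Longrightarrow> x \<in> cell N i j \<Longrightarrow> (norm (\<sigma> x))\<^sup>2 \<le> M i j"
  shows "integrable (lebesgue_on Om) (\<lambda>x. (norm (\<sigma> x))\<^sup>2)"
    and "L2_inner \<sigma> \<sigma> \<le> (\<Sum>i<N. \<Sum>j<N. M i j) / (real N)\<^sup>2"
proof -
  let ?g = "glue N (\<lambda>i j x. M i j)"
  have m: "?g \<in> borel_measurable (lebesgue_on Om)"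
    by (rule measurable_glue) (rule continuous_on_const)
  have g: "integrable (lebesgue_on Om) ?g"
    by (rule integral_piecewise_constant(1)[OF N m, where G = M]) (simp add: glue_on_cell)
  have g_eq: "(LINT x|lebesgue_on Om. ?g x) = (\<Sum>i<N. \<Sum>j<N. M i j) / (real N)\<^sup>2"
    by (rule integral_piecewise_constant(2)[OF N m, where G = M]) (simp add: glue_on_cell)
  have ae: "AE x in lebesgue_on Om. (norm (\<sigma> x))\<^sup>2 \<le> ?g x"
    using AE_Om_in_cell[OF N] by (rule eventually_mono) (use le in \<open>auto simp: glue_on_cell\<close>)
  show int: "integrable (lebesgue_on Om) (\<lambda>x. (norm (\<sigma> x))\<^sup>2)"
    by (rule Bochner_Integration.integrable_bound[OF g]) (use meas ae in \<open>auto elim!: eventually_mono\<close>)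
  show "L2_inner \<sigma> \<sigma> \<le> (\<Sum>i<N. \<Sum>j<N. M i j) / (real N)\<^sup>2"
    unfolding L2_inner_def g_eq[symmetric] dot_square_norm using int g ae by (rule integral_mono_AE)
qed

lemma trace_from_closed_cell:
  assumes N: "N > 0" and x: "x \<in> closed_cell N i j"
    and eq: "\<And>y. y \<in> cell N i j \<Longrightarrow> \<sigma> y = A y" and A: "continuous_on UNIV A"
  shows "trace_from (closed_cell N i j) \<sigma> x = A x"
proof -
  have "pt ((real i + 1/2) / N) ((real j + 1/2) / N) \<in> cell N i j" using N by (simp add: mem_cell)
  then have "closure (cell N i j) = closed_cell N i j"
    unfolding cell_def closed_cell_def by (intro closure_box) auto
  then have "x islimpt cell N i j"
    using x open_cell[of N i j] interior_limit_point[of x "cell N i j"]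
    by (auto simp: closure_def interior_open)
  then have nt: "\<not> trivial_limit (at x within cell N i j)" by (simp add: trivial_limit_within)
  have "(A \<longlongrightarrow> A x) (at x within cell N i j)"
    using A by (meson UNIV_I continuous_on_def subset_UNIV tendsto_within_subset)
  then have "(\<sigma> \<longlongrightarrow> A x) (at x within cell N i j)"
    by (rule tendsto_cong[THEN iffD1, rotated]) (simp add: eventually_at_filter eq)
  then show ?thesis
    unfolding trace_from_def interior_closed_cell using nt by (intro tendsto_Lim)
qed

lemma div_row_affine:
  assumes S: "open S" "x \<in> S"
    and \<sigma>: "\<And>y. y \<in> S \<Longrightarrow> \<sigma> y $ 1 $ 1 = a + b * y$1"
     "\<And>y. y \<in> S \<Longrightarrow> \<sigma> y $ 2 $ 2 = c + d * y$2"
     "\<And>y. y \<in> S \<Longrightarrow> \<sigma> y $ 1 $ 2 = p + q * y$1 + r * y$2"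
     "\<And>y. y \<in> S \<Longrightarrow> \<sigma> y $ 2 $ 1 = p + q * y$1 + r * y$2"
  shows "div_row \<sigma> x = vector [b + r, q + d]"
proof -
  have D: "frechet_derivative g (at x) = (\<lambda>h. \<beta> * h$1 + \<gamma> * h$2)"
    if "\<And>y. y \<in> S \<Longrightarrow> g y = \<alpha> + \<beta> * y$1 + \<gamma> * y$2" for g :: "real^2 \<Rightarrow> real" and \<alpha> \<beta> \<gamma>
  proof (rule frechet_derivative_at[symmetric], rule has_derivative_transform_within_open[OF _ S])
    show "((\<lambda>y. \<alpha> + \<beta> * y$1 + \<gamma> * y$2) has_derivative (\<lambda>h. \<beta> * h$1 + \<gamma> * h$2)) (at x)"
      by (auto intro!: derivative_eq_intros bounded_linear.has_derivative[OF bounded_linear_vec_nth])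
  qed (simp add: that)
  have "frechet_derivative (\<lambda>y. \<sigma> y $ 1 $ 1) (at x) = (\<lambda>h. b * h$1 + 0 * h$2)"
    "frechet_derivative (\<lambda>y. \<sigma> y $ 2 $ 2) (at x) = (\<lambda>h. 0 * h$1 + d * h$2)"
    "frechet_derivative (\<lambda>y. \<sigma> y $ 1 $ 2) (at x) = (\<lambda>h. q * h$1 + r * h$2)"
    "frechet_derivative (\<lambda>y. \<sigma> y $ 2 $ 1) (at x) = (\<lambda>h. q * h$1 + r * h$2)"
    by (rule D; simp add: \<sigma>)+
  then show ?thesis
    by (simp add: div_row_def vec_eq_iff forall_2 UNIV_2 axis_def)
qed

text \<open>
  The matrix field on one cell with the edge values \<open>a\<close> of the first and \<open>b\<close> of the second
  diagonal entry, whose off-diagonal entry is the affine function that takes at the midpoint of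
  each edge the mean of the values of \<open>c\<close> at its two end points. Such a function exists because
  the two means on opposite edges add up to half the sum of all four vertex values in both
  directions.
\<close>

definition stress_aff :: "nat \<Rightarrow> (nat \<Rightarrow> nat \<Rightarrow> real) \<Rightarrow> (nat \<Rightarrow> nat \<Rightarrow> real) \<Rightarrow> (nat \<Rightarrow> nat \<Rightarrow> real)
    \<Rightarrow> nat \<Rightarrow> nat \<Rightarrow> real^2 \<Rightarrow> real^2^2" where
  "stress_aff N a b c i j x =
    (let X = real N * x$1 - real i; Y = real N * x$2 - real j;
         s = (c i j + c (Suc i) j + c i (Suc j) + c (Suc i) (Suc j)) / 4
           + (X - 1/2) * ((c (Suc i) j + c (Suc i) (Suc j) - c i j - c i (Suc j)) / 2)
           + (Y - 1/2) * ((c i (Suc j) + c (Suc i) (Suc j) - c i j - c (Suc i) j) / 2)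
     in vector [vector [a i j + X * (a (Suc i) j - a i j), s],
                vector [s, b i j + Y * (b i (Suc j) - b i j)]])"

lemma continuous_on_vector_2:
  fixes g h :: "'a::topological_space \<Rightarrow> 'b::{topological_space,zero}"
  assumes "continuous_on S g" "continuous_on S h"
  shows "continuous_on S (\<lambda>x. vector [g x, h x] :: 'b^2)"
proof -
  have "continuous_on S (\<lambda>x. (vector [g x, h x] :: 'b^2) $ i)" for i
    using assms exhaust_2[of i] by auto
  then have "continuous_on S (\<lambda>x. \<chi> i. (vector [g x, h x] :: 'b^2) $ i)"
    by (rule continuous_on_vec_lambda)
  then show ?thesis by simp
qed

lemma continuous_stress_aff: "continuous_on UNIV (stress_aff N a b c i j)"
  unfolding stress_aff_def Let_def by (intro continuous_on_vector_2 continuous_intros)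

text \<open>
  The piecewise affine stress field with edge values \<open>a\<close>, \<open>b\<close> and vertex values \<open>c\<close>.
\<close>

definition stress :: "nat \<Rightarrow> (nat \<Rightarrow> nat \<Rightarrow> real) \<Rightarrow> (nat \<Rightarrow> nat \<Rightarrow> real) \<Rightarrow> (nat \<Rightarrow> nat \<Rightarrow> real)
    \<Rightarrow> real^2 \<Rightarrow> real^2^2" where
  "stress N a b c = glue N (stress_aff N a b c)"

lemma trace_stress:
  assumes "i < N" "j < N" "x \<in> closed_cell N i j"
  shows "trace_from (closed_cell N i j) (stress N a b c) x = stress_aff N a b c i j x"
  using assms by (intro trace_from_closed_cell continuous_stress_aff) (auto simp: stress_def glue_on_cell)

text \<open>
  The traces from the two sides of an edge depend only on the values attached to the edge and its
  end points; this is all that the continuity and boundary conditions need.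
\<close>

lemma trace_vertical_edge:
  assumes e: "e = (pt (real i / real N) (real j / real N), pt (real i / real N) (real (j + 1) / real N))"
    and N: "N > 0" and K: "K \<in> mesh N" "edge_set e \<subseteq> K"
  shows "x \<in> edge_set e \<Longrightarrow> trace_from K (stress N a b c) x $ 1 $ 1 = a i j"
    and "trace_from K (stress N a b c) (edge_mid e) $ 1 $ 2 = (c i j + c i (Suc j)) / 2"
    and "trace_from K (stress N a b c) (edge_mid e) $ 2 $ 1 = (c i j + c i (Suc j)) / 2"
proof -
  obtain k l where kl: "k < N" "l < N" "K = closed_cell N k l" using K by (auto simp: mesh_eq)
  have "fst e \<in> K" "snd e \<in> K" using K(2) by (auto simp: edge_set_def)
  then have l: "l = j" and k: "k = i \<or> i = Suc k"
    using N unfolding kl e mem_closed_cell[OF N] by auto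
  have x1: "real N * x$1 = real i" if x: "x \<in> edge_set e" for x
  proof -
    obtain u where "x = (1 - u) *\<^sub>R fst e + u *\<^sub>R snd e"
      using x by (auto simp: edge_set_def closed_segment_def)
    then have "x$1 = (1 - u) * fst e $ 1 + u * snd e $ 1" by simp
    then show ?thesis using N by (simp add: e field_simps)
  qed
  have mid: "edge_mid e \<in> edge_set e" by (simp add: edge_mid_def edge_set_def)
  have m2: "real N * edge_mid e $ 2 = real j + 1/2"
    using N by (simp add: edge_mid_def midpoint_def e field_simps)
  have tr: "trace_from K (stress N a b c) (edge_mid e) = stress_aff N a b c k j (edge_mid e)"
    using K(2) mid kl l by (auto simp: trace_stress)
  show "trace_from K (stress N a b c) x $ 1 $ 1 = a i j" if "x \<in> edge_set e"
    using K(2) that k x1[OF that] kl by (auto simp: trace_stress stress_aff_def Let_def l subset_iff)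
  show "trace_from K (stress N a b c) (edge_mid e) $ 1 $ 2 = (c i j + c i (Suc j)) / 2"
    and "trace_from K (stress N a b c) (edge_mid e) $ 2 $ 1 = (c i j + c i (Suc j)) / 2"
    unfolding tr stress_aff_def Let_def x1[OF mid] m2 using k by (auto simp: field_simps)
qed

lemma trace_horizontal_edge:
  assumes e: "e = (pt (real i / real N) (real j / real N), pt (real (i + 1) / real N) (real j / real N))"
    and N: "N > 0" and K: "K \<in> mesh N" "edge_set e \<subseteq> K"
  shows "x \<in> edge_set e \<Longrightarrow> trace_from K (stress N a b c) x $ 2 $ 2 = b i j"
    and "trace_from K (stress N a b c) (edge_mid e) $ 1 $ 2 = (c i j + c (Suc i) j) / 2"
    and "trace_from K (stress N a b c) (edge_mid e) $ 2 $ 1 = (c i j + c (Suc i) j) / 2"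
proof -
  obtain k l where kl: "k < N" "l < N" "K = closed_cell N k l" using K by (auto simp: mesh_eq)
  have "fst e \<in> K" "snd e \<in> K" using K(2) by (auto simp: edge_set_def)
  then have k: "k = i" and l: "l = j \<or> j = Suc l"
    using N unfolding kl e mem_closed_cell[OF N] by auto
  have x2: "real N * x$2 = real j" if x: "x \<in> edge_set e" for x
  proof -
    obtain u where "x = (1 - u) *\<^sub>R fst e + u *\<^sub>R snd e"
      using x by (auto simp: edge_set_def closed_segment_def)
    then have "x$2 = (1 - u) * fst e $ 2 + u * snd e $ 2" by simp
    then show ?thesis using N by (simp add: e field_simps)
  qed
  have mid: "edge_mid e \<in> edge_set e" by (simp add: edge_mid_def edge_set_def)
  have m1: "real N * edge_mid e $ 1 = real i + 1/2"
    using N by (simp add: edge_mid_def midpoint_def e field_simps)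
  have tr: "trace_from K (stress N a b c) (edge_mid e) = stress_aff N a b c i l (edge_mid e)"
    using K(2) mid kl k by (auto simp: trace_stress)
  show "trace_from K (stress N a b c) x $ 2 $ 2 = b i j" if "x \<in> edge_set e"
    using K(2) that l x2[OF that] kl by (auto simp: trace_stress stress_aff_def Let_def k subset_iff)
  show "trace_from K (stress N a b c) (edge_mid e) $ 1 $ 2 = (c i j + c (Suc i) j) / 2"
    and "trace_from K (stress N a b c) (edge_mid e) $ 2 $ 1 = (c i j + c (Suc i) j) / 2"
    unfolding tr stress_aff_def Let_def x2[OF mid] m1 using l by (auto simp: field_simps)
qed

lemma boundary_vertical_edge:
  assumes e: "e = (pt (real i / real N) (real j / real N), pt (real i / real N) (real (j + 1) / real N))"
    and ij: "i \<le> N" "j < N" and bd: "boundary_edge e"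
  shows "i = 0 \<or> i = N"
proof (rule ccontr)
  assume "\<not> (i = 0 \<or> i = N)"
  then have "0 < i" "i < N" "real j + 1 \<le> N" using ij by auto
  then have "edge_mid e \<in> Om"
    by (simp add: mem_Om edge_mid_def midpoint_def e field_simps)
  moreover have "edge_mid e \<in> frontier Om"
    using bd by (auto simp: boundary_edge_def edge_mid_def edge_set_def)
  ultimately show False using open_Om by (simp add: frontier_def interior_open)
qed

lemma boundary_horizontal_edge:
  assumes e: "e = (pt (real i / real N) (real j / real N), pt (real (i + 1) / real N) (real j / real N))"
    and ij: "i < N" "j \<le> N" and bd: "boundary_edge e"
  shows "j = 0 \<or> j = N"
proof (rule ccontr)
  assume "\<not> (j = 0 \<or> j = N)"
  then have "0 < j" "j < N" "real i + 1 \<le> N" using ij by auto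
  then have "edge_mid e \<in> Om"
    by (simp add: mem_Om edge_mid_def midpoint_def e field_simps)
  moreover have "edge_mid e \<in> frontier Om"
    using bd by (auto simp: boundary_edge_def edge_mid_def edge_set_def)
  ultimately show False using open_Om by (simp add: frontier_def interior_open)
qed

lemma stress_components:
  assumes "i < N" "j < N" "x \<in> cell N i j"
  shows "stress N a b c x $ 1 $ 1 = (a i j - real i * (a (Suc i) j - a i j)) + (real N * (a (Suc i) j - a i j)) * x$1"
    "stress N a b c x $ 2 $ 2 = (b i j - real j * (b i (Suc j) - b i j)) + (real N * (b i (Suc j) - b i j)) * x$2"
    "stress N a b c x $ 1 $ 2 = ((c i j + c (Suc i) j + c i (Suc j) + c (Suc i) (Suc j)) / 4
           - (real i + 1/2) * ((c (Suc i) j + c (Suc i) (Suc j) - c i j - c i (Suc j)) / 2)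
           - (real j + 1/2) * ((c i (Suc j) + c (Suc i) (Suc j) - c i j - c (Suc i) j) / 2))
       + (real N * (c (Suc i) j + c (Suc i) (Suc j) - c i j - c i (Suc j)) / 2) * x$1
       + (real N * (c i (Suc j) + c (Suc i) (Suc j) - c i j - c (Suc i) j) / 2) * x$2"
    "stress N a b c x $ 2 $ 1 = stress N a b c x $ 1 $ 2"
  using assms by (simp_all add: stress_def glue_on_cell stress_aff_def Let_def field_simps)

lemma stress_sym: "stress N a b c x \<in> SymMat"
  by (simp add: stress_def glue_def SymMat_def transpose_def vec_eq_iff forall_2 stress_aff_def Let_def)

lemma stress_measurable: "stress N a b c \<in> borel_measurable (lebesgue_on Om)"
  unfolding stress_def by (rule measurable_glue) (rule continuous_stress_aff)

lemma div_h_stress: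
  assumes ij: "i < N" "j < N" and x: "x \<in> cell N i j"
  shows "div_h N (stress N a b c) x = vector
    [real N * (a (Suc i) j - a i j) + real N * (c i (Suc j) + c (Suc i) (Suc j) - c i j - c (Suc i) j) / 2,
     real N * (c (Suc i) j + c (Suc i) (Suc j) - c i j - c i (Suc j)) / 2 + real N * (b i (Suc j) - b i j)]"
proof -
  have "closed_cell N i j \<in> mesh N" using ij by (auto simp: mesh_eq)
  then have "div_h N (stress N a b c) x = div_row (stress N a b c) x"
    using x interior_closed_cell unfolding div_h_def by metis
  also have "\<dots> = vector
    [real N * (a (Suc i) j - a i j) + real N * (c i (Suc j) + c (Suc i) (Suc j) - c i j - c (Suc i) j) / 2,
     real N * (c (Suc i) j + c (Suc i) (Suc j) - c i j - c i (Suc j)) / 2 + real N * (b i (Suc j) - b i j)]"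
    by (rule div_row_affine[OF open_cell x]) (simp_all only: stress_components[OF ij])
  finally show ?thesis .
qed

lemma stress_in_Sigma_h0:
  assumes N: "N > 0"
    and a: "\<And>j. j < N \<Longrightarrow> a 0 j = 0" "\<And>j. j < N \<Longrightarrow> a N j = 0"
    and b: "\<And>i. i < N \<Longrightarrow> b i 0 = 0" "\<And>i. i < N \<Longrightarrow> b i N = 0"
    and c: "\<And>j. c 0 j = 0" "\<And>j. c N j = 0" "\<And>i. c i 0 = 0" "\<And>i. c i N = 0"
    and int: "integrable (lebesgue_on Om) (\<lambda>x. (norm (stress N a b c x))\<^sup>2)"
  shows "stress N a b c \<in> Sigma_h0 N"
proof -
  let ?s = "stress N a b c"
  have "?s \<in> L2_Om SymMat"
    using int by (simp add: L2_Om_def stress_measurable stress_sym)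
  moreover have "?s \<in> Sigma_loc K" if K: "K \<in> mesh N" for K
  proof -
    obtain i j where ij: "i < N" "j < N" and Keq: "K = closed_cell N i j" using K by (auto simp: mesh_eq)
    show ?thesis unfolding Sigma_loc_def Keq interior_closed_cell mem_Collect_eq
      by (intro exI ballI conjI; rule stress_components[OF ij]; assumption)
  qed
  moreover have "comp_continuous_at N ?s 1 1 e x" if ed: "e \<in> vertical_edges N" "x \<in> edge_set e" for e x
  proof -
    obtain i j where e: "e = (pt (real i / real N) (real j / real N), pt (real i / real N) (real (j + 1) / real N))"
      using ed by (auto simp: vertical_edges_def)
    show ?thesis using ed(2) by (simp add: comp_continuous_at_def trace_vertical_edge[OF e N])
  qed
  moreover have "comp_continuous_at N ?s 2 2 e x" if ed: "e \<in> horizontal_edges N" "x \<in> edge_set e" for e x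
  proof -
    obtain i j where e: "e = (pt (real i / real N) (real j / real N), pt (real (i + 1) / real N) (real j / real N))"
      using ed by (auto simp: horizontal_edges_def)
    show ?thesis using ed(2) by (simp add: comp_continuous_at_def trace_horizontal_edge[OF e N])
  qed
  moreover have "comp_continuous_at N ?s 1 2 e (edge_mid e)" if "e \<in> edges N" for e
    using that unfolding edges_def
  proof
    assume "e \<in> vertical_edges N"
    then obtain i j where e: "e = (pt (real i / real N) (real j / real N), pt (real i / real N) (real (j + 1) / real N))"
      by (auto simp: vertical_edges_def)
    show ?thesis by (simp add: comp_continuous_at_def trace_vertical_edge[OF e N])
  next
    assume "e \<in> horizontal_edges N"
    then obtain i j where e: "e = (pt (real i / real N) (real j / real N), pt (real (i + 1) / real N) (real j / real N))"
      by (auto simp: horizontal_edges_def)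
    show ?thesis by (simp add: comp_continuous_at_def trace_horizontal_edge[OF e N])
  qed
  moreover have "trace_from K ?s (edge_mid e) *v n = 0"
    if e: "e \<in> edges N" "boundary_edge e" and K: "K \<in> mesh N" "edge_set e \<subseteq> K" and n: "unit_normal e n" for e K n
    using e(1) unfolding edges_def
  proof
    have mid: "edge_mid e \<in> edge_set e" by (simp add: edge_mid_def edge_set_def)
    assume "e \<in> vertical_edges N"
    then obtain i j where ij: "i \<le> N" "j < N"
      and eq: "e = (pt (real i / real N) (real j / real N), pt (real i / real N) (real (j + 1) / real N))"
      by (auto simp: vertical_edges_def)
    have "i = 0 \<or> i = N" using boundary_vertical_edge[OF eq ij e(2)] .
    then have z: "a i j = 0" "c i j = 0" "c i (Suc j) = 0" using ij a c by auto
    have n2: "n $ 2 = 0"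
      using n N by (simp add: unit_normal_def eq inner_vec_def UNIV_2 diff_divide_distrib[symmetric])
    show ?thesis using trace_vertical_edge[OF eq N K, where a = a and b = b and c = c] mid
      by (simp add: vec_eq_iff forall_2 matrix_vector_mult_def UNIV_2 z n2)
  next
    have mid: "edge_mid e \<in> edge_set e" by (simp add: edge_mid_def edge_set_def)
    assume "e \<in> horizontal_edges N"
    then obtain i j where ij: "i < N" "j \<le> N"
      and eq: "e = (pt (real i / real N) (real j / real N), pt (real (i + 1) / real N) (real j / real N))"
      by (auto simp: horizontal_edges_def)
    have "j = 0 \<or> j = N" using boundary_horizontal_edge[OF eq ij e(2)] .
    then have z: "b i j = 0" "c i j = 0" "c (Suc i) j = 0" using ij b c by auto
    have n1: "n $ 1 = 0"
      using n N by (simp add: unit_normal_def eq inner_vec_def UNIV_2 diff_divide_distrib[symmetric])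
    show ?thesis using trace_horizontal_edge[OF eq N K, where a = a and b = b and c = c] mid
      by (simp add: vec_eq_iff forall_2 matrix_vector_mult_def UNIV_2 z n1)
  qed
  ultimately show ?thesis by (auto simp: Sigma_h0_def Sigma_h_def)
qed

lemma stress_bound:
  assumes ij: "i < N" "j < N" and x: "x \<in> cell N i j"
    and a: "\<bar>a i j\<bar> \<le> A" "\<bar>a (Suc i) j\<bar> \<le> A" and b: "\<bar>b i j\<bar> \<le> B" "\<bar>b i (Suc j)\<bar> \<le> B"
    and c: "\<bar>c i j\<bar> \<le> C" "\<bar>c (Suc i) j\<bar> \<le> C" "\<bar>c i (Suc j)\<bar> \<le> C" "\<bar>c (Suc i) (Suc j)\<bar> \<le> C"
  shows "(norm (stress N a b c x))\<^sup>2 \<le> A\<^sup>2 + B\<^sup>2 + 2 * (4 * C)\<^sup>2"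
proof -
  define X Y where "X = real N * x$1 - real i" and "Y = real N * x$2 - real j"
  have XY: "0 \<le> X" "X \<le> 1" "0 \<le> Y" "Y \<le> 1" using x ij by (auto simp: mem_cell X_def Y_def)
  have cvx: "\<bar>u + t * (v - u)\<bar> \<le> K" if "0 \<le> t" "t \<le> 1" "\<bar>u\<bar> \<le> K" "\<bar>v\<bar> \<le> K" for t u v K :: real
  proof -
    have "\<bar>u + t * (v - u)\<bar> = \<bar>(1 - t) * u + t * v\<bar>" by (simp add: algebra_simps)
    also have "\<dots> \<le> (1 - t) * \<bar>u\<bar> + t * \<bar>v\<bar>" using that(1,2) by (intro order_trans[OF abs_triangle_ineq]) (simp add: abs_mult)
    also have "\<dots> \<le> (1 - t) * K + t * K" using that by (intro add_mono mult_left_mono) auto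
    finally show ?thesis by (simp add: algebra_simps)
  qed
  let ?s = "stress_aff N a b c i j x"
  have s11: "\<bar>?s $ 1 $ 1\<bar> \<le> A" and s22: "\<bar>?s $ 2 $ 2\<bar> \<le> B"
    using cvx[OF XY(1,2) a] cvx[OF XY(3,4) b] by (simp_all add: stress_aff_def Let_def X_def Y_def)
  have half: "\<bar>(t - 1/2) * (u / 2)\<bar> \<le> \<bar>u\<bar> / 4" if "0 \<le> t" "t \<le> 1" for t u :: real
  proof -
    have "\<bar>t - 1/2\<bar> * (\<bar>u\<bar> / 2) \<le> 1/2 * (\<bar>u\<bar> / 2)" using that by (intro mult_right_mono) (auto simp: abs_if)
    then show ?thesis by (simp add: abs_mult)
  qed
  define s u v where "s = c i j + c (Suc i) j + c i (Suc j) + c (Suc i) (Suc j)"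
    and "u = c (Suc i) j + c (Suc i) (Suc j) - c i j - c i (Suc j)"
    and "v = c i (Suc j) + c (Suc i) (Suc j) - c i j - c (Suc i) j"
  have suv: "\<bar>s\<bar> \<le> 4 * C" "\<bar>u\<bar> \<le> 4 * C" "\<bar>v\<bar> \<le> 4 * C"
    unfolding s_def u_def v_def using c by linarith+
  have "?s $ 1 $ 2 = s / 4 + (X - 1/2) * (u / 2) + (Y - 1/2) * (v / 2)"
    by (simp add: stress_aff_def Let_def s_def u_def v_def X_def Y_def)
  then have "\<bar>?s $ 1 $ 2\<bar> \<le> 4 * C"
    using suv half[OF XY(1,2), of u] half[OF XY(3,4), of v] by linarith
  then have "(?s $ 1 $ 1)\<^sup>2 \<le> A\<^sup>2" "(?s $ 2 $ 2)\<^sup>2 \<le> B\<^sup>2" "(?s $ 1 $ 2)\<^sup>2 \<le> (4 * C)\<^sup>2"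
    using s11 s22 by (simp_all only: abs_le_square_iff[symmetric])
  moreover have "?s $ 2 $ 1 = ?s $ 1 $ 2" by (simp add: stress_aff_def Let_def)
  moreover have "(norm ?s)\<^sup>2 = (?s $ 1 $ 1)\<^sup>2 + (?s $ 1 $ 2)\<^sup>2 + ((?s $ 2 $ 1)\<^sup>2 + (?s $ 2 $ 2)\<^sup>2)"
    unfolding power2_norm_eq_inner inner_vec_def UNIV_2 by (simp add: power2_eq_square)
  ultimately show ?thesis using x ij by (simp add: stress_def glue_on_cell)
qed

section \<open>The bounded right inverse and the inf-sup condition\<close>

lemma continuous_zero_on_cell_if_AE:
  assumes ij: "i < N" "j < N" and ae: "AE x in lebesgue_on Om. P x"
    and cont: "continuous_on (cell N i j) g" and P: "\<And>x. x \<in> cell N i j \<Longrightarrow> P x \<Longrightarrow> g x = (0::'a::real_normed_vector)"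
    and x: "x \<in> cell N i j"
  shows "g x = 0"
proof (rule ccontr)
  assume gx: "g x \<noteq> 0"
  define U where "U = {y \<in> cell N i j. g y \<noteq> 0}"
  have "open (cell N i j \<inter> g -` (- {0}))"
    using continuous_open_preimage[OF cont open_cell, of "- {0}"] by auto
  moreover have "cell N i j \<inter> g -` (- {0}) = U" by (auto simp: U_def)
  ultimately have "open U" by simp
  have "AE x in lebesgue. x \<in> Om \<longrightarrow> P x"
    using ae by (subst (asm) AE_restrict_space_iff) (use open_Om in simp_all)
  then have "AE x in lebesgue. x \<notin> U"
    by (rule eventually_mono) (use P cell_subset_Om[OF ij] in \<open>auto simp: U_def\<close>)
  then have "U \<in> null_sets lebesgue" using \<open>open U\<close> by (simp add: AE_iff_null_sets)
  then have "negligible U" by (simp add: negligible_iff_null_sets)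
  then show False using open_not_negligible[OF \<open>open U\<close>] x gx by (auto simp: U_def)
qed

lemma V_h_obtain:
  assumes N: "N > 0" and v: "v \<in> V_h N"
  obtains f g where "\<And>i j x. i < N \<Longrightarrow> j < N \<Longrightarrow> x \<in> cell N i j \<Longrightarrow> v x = vector [f i j, g i j]"
proof -
  define m where "m i j = pt ((real i + 1/2) / N) ((real j + 1/2) / N)" for i j
  have m: "m i j \<in> cell N i j" for i j using N by (simp add: mem_cell m_def)
  have "v x = vector [v (m i j) $ 1, v (m i j) $ 2]" if ij: "i < N" "j < N" and x: "x \<in> cell N i j" for i j x
  proof -
    have "closed_cell N i j \<in> mesh N" using ij by (auto simp: mesh_eq)
    then obtain c where "\<And>x. x \<in> cell N i j \<Longrightarrow> v x = c"
      using v by (force simp: V_h_def interior_closed_cell)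
    then have "v x = v (m i j)" using m x by metis
    then show ?thesis by (simp add: vec_eq_iff forall_2)
  qed
  then show ?thesis by (rule that)
qed

text \<open>
  Orthogonality to the rigid motions in terms of the cell values. Affine functions may be
  integrated by the midpoint rule, and the offset \<open>1/2\<close> of the midpoints drops out because both
  components have mean zero.
\<close>

lemma V_h0_moments:
  assumes N: "N > 0" and v: "v \<in> V_h0 N"
    and eq: "\<And>i j x. i < N \<Longrightarrow> j < N \<Longrightarrow> x \<in> cell N i j \<Longrightarrow> v x = vector [f i j, g i j]"
  shows "(\<Sum>i<N. \<Sum>j<N. f i j) = 0" and "(\<Sum>i<N. \<Sum>j<N. g i j) = 0"
    and "(\<Sum>i<N. \<Sum>j<N. real j * f i j) = (\<Sum>i<N. \<Sum>j<N. real i * g i j)"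
proof -
  have meas: "v \<in> borel_measurable (lebesgue_on Om)" using v by (simp add: V_h0_def V_h_def L2_Om_def)
  have I: "(\<Sum>i<N. \<Sum>j<N. (\<alpha> * f i j + \<beta> * g i j) + (- \<gamma> * g i j) * ((real i + 1/2) / N)
      + (\<gamma> * f i j) * ((real j + 1/2) / N)) = 0" for \<alpha> \<beta> \<gamma>
  proof -
    define w where "w = (\<lambda>x::real^2. \<alpha> *\<^sub>R vector [1, 0] + \<beta> *\<^sub>R vector [0, 1] + \<gamma> *\<^sub>R vector [x$2, - (x$1)] :: real^2)"
    have "continuous_on UNIV w"
      unfolding w_def by (intro continuous_on_vector_2 continuous_intros)
    then have "w \<in> borel_measurable lebesgue"
      by (intro measurable_completion) (simp add: borel_measurable_continuous_onI)
    then have "w \<in> borel_measurable (lebesgue_on Om)" by (rule measurable_restrict_space1)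
    then have "(\<lambda>x. v x \<bullet> w x) \<in> borel_measurable (lebesgue_on Om)"
      using meas by (rule borel_measurable_inner[rotated])
    then have "has_bochner_integral (lebesgue_on Om) (\<lambda>x. v x \<bullet> w x) ((\<Sum>i<N. \<Sum>j<N. (\<alpha> * f i j + \<beta> * g i j)
      + (- \<gamma> * g i j) * ((real i + 1/2) / N) + (\<gamma> * f i j) * ((real j + 1/2) / N)) / (real N)\<^sup>2)"
      by (rule has_bochner_integral_piecewise_affine[OF N])
        (simp add: eq w_def inner_vec_def UNIV_2 algebra_simps)
    moreover have "w \<in> RM" unfolding w_def RM_def by blast
    then have "L2_inner v w = 0" using v by (simp add: V_h0_def)
    ultimately show ?thesis using N
      unfolding L2_inner_def by (simp only: has_bochner_integral_iff) (simp del: mult_minus_left)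
  qed
  show f0: "(\<Sum>i<N. \<Sum>j<N. f i j) = 0" using I[of 1 0 0] by simp
  show g0: "(\<Sum>i<N. \<Sum>j<N. g i j) = 0" using I[of 0 1 0] by simp
  have "0 = (\<Sum>i<N. \<Sum>j<N. (0 * f i j + 0 * g i j) + (- 1 * g i j) * ((real i + 1/2) / N)
      + (1 * f i j) * ((real j + 1/2) / N))" by (rule I[symmetric])
  also have "\<dots> = (\<Sum>i<N. \<Sum>j<N. (real j * f i j - real i * g i j) / N + (f i j - g i j) / (2 * N))"
    using N by (intro sum.cong refl) (simp add: field_simps)
  also have "\<dots> = ((\<Sum>i<N. \<Sum>j<N. real j * f i j) - (\<Sum>i<N. \<Sum>j<N. real i * g i j)) / N
      + ((\<Sum>i<N. \<Sum>j<N. f i j) - (\<Sum>i<N. \<Sum>j<N. g i j)) / (2 * N)"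
    by (simp add: sum.distrib sum_subtractf sum_divide_distrib[symmetric])
  finally show "(\<Sum>i<N. \<Sum>j<N. real j * f i j) = (\<Sum>i<N. \<Sum>j<N. real i * g i j)"
    using N by (simp add: f0 g0)
qed

text \<open>
  The elementwise divergence is 0 on the grid lines by definition, so it equals the glued function
  everywhere.
\<close>

lemma measurable_div_h:
  assumes eq: "\<And>i j x. i < N \<Longrightarrow> j < N \<Longrightarrow> x \<in> cell N i j \<Longrightarrow> div_h N \<sigma> x = F i j"
  shows "div_h N \<sigma> \<in> borel_measurable (lebesgue_on Om)"
proof -
  have "div_h N \<sigma> x = glue N (\<lambda>i j x. F i j) x" for x
  proof (cases "\<exists>i<N. \<exists>j<N. x \<in> cell N i j")
    case True
    then show ?thesis using eq by (auto simp: glue_on_cell)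
  next
    case False
    then have "indicator (cell N i j) x = (0::real)" if "i < N" "j < N" for i j
      using that by (auto simp: indicator_def)
    moreover have "div_h N \<sigma> x = 0"
      using False by (auto simp: div_h_def mesh_eq interior_closed_cell)
    ultimately show ?thesis by (simp add: glue_def)
  qed
  then have "div_h N \<sigma> = glue N (\<lambda>i j x. F i j)" by (rule ext)
  then show ?thesis using measurable_glue[of "\<lambda>i j x. F i j"] by simp
qed

text \<open>
  The elementwise divergence maps the discrete stresses with vanishing boundary traction onto the
  piecewise constant fields orthogonal to the rigid motions, with a right inverse that is bounded in L2 uniformly in \<open>N\<close>.
\<close>

lemma bounded_right_inverse_div_h:
  assumes N: "N \<ge> 1" and v: "v \<in> V_h0 N"
  obtains \<sigma> where "\<sigma> \<in> Sigma_h0 N"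
    "\<And>i j x. i < N \<Longrightarrow> j < N \<Longrightarrow> x \<in> cell N i j \<Longrightarrow> div_h N \<sigma> x = v x"
    "div_h N \<sigma> \<in> borel_measurable (lebesgue_on Om)"
    "L2_inner \<sigma> \<sigma> \<le> 9999 * L2_inner v v"
    "L2_zero \<sigma> \<Longrightarrow> L2_zero v"
proof -
  have N0: "N > 0" using N by simp
  have vV: "v \<in> V_h N" using v by (simp add: V_h0_def)
  obtain f g where fg: "\<And>i j x. i < N \<Longrightarrow> j < N \<Longrightarrow> x \<in> cell N i j \<Longrightarrow> v x = vector [f i j, g i j]"
    using V_h_obtain[OF N0 vV] by blast
  have f0: "(\<Sum>i<N. \<Sum>j<N. f i j) = 0"
    by (rule V_h0_moments(1)[OF N0 v]) (rule fg)
  have g0: "(\<Sum>i<N. \<Sum>j<N. g i j) = 0"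
    by (rule V_h0_moments(2)[OF N0 v]) (rule fg)
  have mom: "(\<Sum>i<N. \<Sum>j<N. real j * f i j) = (\<Sum>i<N. \<Sum>j<N. real i * g i j)"
    by (rule V_h0_moments(3)[OF N0 v]) (rule fg)
  define P where "P = (\<Sum>i<N. \<Sum>j<N. \<bar>f i j\<bar> + \<bar>g i j\<bar>) / (real N)\<^sup>2"
  obtain a b c where abc: "\<And>j. a 0 j = 0" "\<And>j. j < N \<Longrightarrow> a N j = 0"
    "\<And>i. b i 0 = 0" "\<And>i. i < N \<Longrightarrow> b i N = 0"
    "\<And>j. c 0 j = 0" "\<And>j. c N j = 0" "\<And>i. c i 0 = 0" "\<And>i. c i N = 0"
    and div: "\<And>i j. i < N \<Longrightarrow> j < N \<Longrightarrow> real N * (a (Suc i) j - a i j)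
        + real N * (c i (Suc j) + c (Suc i) (Suc j) - c i j - c (Suc i) j) / 2 = f i j"
    "\<And>i j. i < N \<Longrightarrow> j < N \<Longrightarrow> real N * (b i (Suc j) - b i j)
        + real N * (c (Suc i) j + c (Suc i) (Suc j) - c i j - c i (Suc j)) / 2 = g i j"
    and bnd: "\<And>i j. i \<le> N \<Longrightarrow> j < N \<Longrightarrow> \<bar>a i j\<bar> \<le> 3 * ((\<Sum>k<N. \<bar>f k j\<bar>) / N) + 18 * P"
    "\<And>i j. i < N \<Longrightarrow> j \<le> N \<Longrightarrow> \<bar>b i j\<bar> \<le> 3 * ((\<Sum>k<N. \<bar>g i k\<bar>) / N) + 18 * P"
    "\<And>i j. i \<le> N \<Longrightarrow> j \<le> N \<Longrightarrow> \<bar>c i j\<bar> \<le> 8 * P"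
  proof (rule discrete_right_inverse[where f = f and g = g, OF N f0 g0 mom, folded P_def], goal_cases)
    case (1 a b c)
    from 1(2-) show ?case by (rule that[of a b c])
  qed
  define \<sigma> where "\<sigma> = stress N a b c"
  define M where "M i j = (3 * ((\<Sum>k<N. \<bar>f k j\<bar>) / N) + 18 * P)\<^sup>2
      + (3 * ((\<Sum>k<N. \<bar>g i k\<bar>) / N) + 18 * P)\<^sup>2 + 2 * (32 * P)\<^sup>2" for i j
  have le: "(norm (\<sigma> x))\<^sup>2 \<le> M i j" if "i < N" "j < N" "x \<in> cell N i j" for i j x
    using stress_bound[OF that, of a "3 * ((\<Sum>k<N. \<bar>f k j\<bar>) / N) + 18 * P"
        b "3 * ((\<Sum>k<N. \<bar>g i k\<bar>) / N) + 18 * P" c "8 * P"] bnd that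
    by (simp add: \<sigma>_def M_def)
  have meas: "\<sigma> \<in> borel_measurable (lebesgue_on Om)" unfolding \<sigma>_def by (rule stress_measurable)
  have L2: "integrable (lebesgue_on Om) (\<lambda>x. (norm (\<sigma> x))\<^sup>2)"
    "L2_inner \<sigma> \<sigma> \<le> (\<Sum>i<N. \<Sum>j<N. M i j) / (real N)\<^sup>2"
    by (rule L2_inner_self_le[where M = M, OF N0 meas], rule le, assumption+)+
  have mem: "\<sigma> \<in> Sigma_h0 N"
    unfolding \<sigma>_def by (rule stress_in_Sigma_h0[OF N0]) (use abc L2(1) in \<open>simp_all add: \<sigma>_def\<close>)
  have dv: "div_h N \<sigma> x = v x" if "i < N" "j < N" "x \<in> cell N i j" for i j x
    unfolding \<sigma>_def div_h_stress[OF that] fg[OF that]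
    using div[OF that(1,2)] by (simp add: add.commute)
  have "L2_inner v v = (\<Sum>i<N. \<Sum>j<N. (f i j)\<^sup>2 + (g i j)\<^sup>2) / (real N)\<^sup>2"
    unfolding L2_inner_def
  proof (rule integral_piecewise_constant(2)[OF N0])
    have "v \<in> borel_measurable (lebesgue_on Om)" using vV by (simp add: V_h_def L2_Om_def)
    then show "(\<lambda>x. v x \<bullet> v x) \<in> borel_measurable (lebesgue_on Om)" by (intro borel_measurable_inner)
  qed (simp add: fg inner_vec_def UNIV_2 power2_eq_square)
  then have "L2_inner \<sigma> \<sigma> \<le> 9999 * L2_inner v v"
    using L2(2) discrete_energy_bound[OF N, of f g] by (simp add: M_def P_def)
  moreover have "L2_zero v" if z: "L2_zero \<sigma>"
  proof -
    have "v x = 0" if ij: "i < N" "j < N" and x: "x \<in> cell N i j" for i j x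
    proof -
      \<comment> \<open>A field that vanishes almost everywhere vanishes on each open cell, since it is continuous there.\<close>
      have zero: "\<sigma> y = 0" if "y \<in> cell N i j" for y
      proof -
        have "stress_aff N a b c i j y = 0"
          using ij z[unfolded L2_zero_def] continuous_on_subset[OF continuous_stress_aff subset_UNIV] _ that
          by (rule continuous_zero_on_cell_if_AE) (use ij in \<open>simp add: \<sigma>_def stress_def glue_on_cell\<close>)
        then show ?thesis using that ij by (simp add: \<sigma>_def stress_def glue_on_cell)
      qed
      have "div_row \<sigma> x = vector [0 + 0, 0 + 0]"
        by (rule div_row_affine[OF open_cell x, of _ 0 _ 0 _ 0 _ 0]) (simp_all add: zero)
      moreover have "closed_cell N i j \<in> mesh N" using ij by (auto simp: mesh_eq)
      then have "div_h N \<sigma> x = div_row \<sigma> x"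
        using x interior_closed_cell unfolding div_h_def by metis
      ultimately show ?thesis using dv[OF ij x] by (simp add: vec_eq_iff forall_2)
    qed
    then show ?thesis
      unfolding L2_zero_def using AE_Om_in_cell[OF N0] by (auto elim!: eventually_mono)
  qed
  moreover have "div_h N \<sigma> \<in> borel_measurable (lebesgue_on Om)"
    by (rule measurable_div_h[where F = "\<lambda>i j. vector [f i j, g i j]"]) (simp add: dv fg)
  ultimately show ?thesis using mem dv by (intro that[of \<sigma>]) simp_all
qed

theorem theorem6p1:
  shows "\<exists>C::real. C > 0 \<and>
    (\<forall>N::nat. N \<ge> 1 \<longrightarrow>
      (INF v \<in> {v \<in> V_h0 N. \<not> L2_zero v}.
        SUP \<sigma> \<in> {\<sigma> \<in> Sigma_h0 N. \<not> L2_zero \<sigma>}.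
          ereal (L2_inner (div_h N \<sigma>) v / (Hdiv_norm N \<sigma> * L2_norm v)))
      \<ge> ereal C)"
proof (intro exI conjI allI impI INF_greatest)
  show "(0::real) < 1 / 100" by simp
next
  fix N :: nat and v assume N: "N \<ge> 1" and "v \<in> {v \<in> V_h0 N. \<not> L2_zero v}"
  then have v: "v \<in> V_h0 N" and nz: "\<not> L2_zero v" by auto
  obtain \<sigma> where \<sigma>: "\<sigma> \<in> Sigma_h0 N"
    and div: "\<And>i j x. i < N \<Longrightarrow> j < N \<Longrightarrow> x \<in> cell N i j \<Longrightarrow> div_h N \<sigma> x = v x"
    and meas: "div_h N \<sigma> \<in> borel_measurable (lebesgue_on Om)"
    and bound: "L2_inner \<sigma> \<sigma> \<le> 9999 * L2_inner v v" and z: "L2_zero \<sigma> \<Longrightarrow> L2_zero v"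
    using bounded_right_inverse_div_h[OF N v] by blast
  define L where "L = L2_inner v v"
  have vL: "v \<in> borel_measurable (lebesgue_on Om)" "integrable (lebesgue_on Om) (\<lambda>x. (norm (v x))\<^sup>2)"
    using v by (simp_all add: V_h0_def V_h_def L2_Om_def)
  have ae: "AE x in lebesgue_on Om. div_h N \<sigma> x = v x"
    using AE_Om_in_cell[of N] N div by (auto elim!: eventually_mono)
  have 1: "L2_inner (div_h N \<sigma>) v = L" "L2_inner (div_h N \<sigma>) (div_h N \<sigma>) = L"
    unfolding L_def L2_inner_def using vL(1) meas ae
    by (auto intro!: integral_cong_AE borel_measurable_inner elim!: eventually_mono)
  \<comment> \<open>The load is nonzero, so the quotient has a positive denominator.\<close>
  have "L \<ge> 0" unfolding L_def L2_inner_def by (rule Bochner_Integration.integral_nonneg) simp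
  moreover have "L \<noteq> 0"
    using nz integral_nonneg_eq_0_iff_AE[OF vL(2)]
    by (auto simp: L_def L2_inner_def L2_zero_def dot_square_norm)
  ultimately have L: "L > 0" by simp
  have "L2_inner \<sigma> \<sigma> \<ge> 0" unfolding L2_inner_def by (rule Bochner_Integration.integral_nonneg) simp
  then have Hdiv: "Hdiv_norm N \<sigma> = sqrt (L2_inner \<sigma> \<sigma> + L)"
    using L by (simp add: Hdiv_norm_def L2_norm_def 1)
  also have "\<dots> \<le> sqrt (100\<^sup>2 * L)" using bound by (simp add: L_def)
  also have "\<dots> = 100 * sqrt L" by (simp add: real_sqrt_mult)
  finally have "Hdiv_norm N \<sigma> \<le> 100 * sqrt L" .
  then have "Hdiv_norm N \<sigma> * sqrt L \<le> 100 * sqrt L * sqrt L" by (rule mult_right_mono) (use L in simp)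
  then have "Hdiv_norm N \<sigma> * sqrt L \<le> 100 * L" using L by (simp only: mult.assoc real_sqrt_mult_self abs_of_pos)
  moreover have "Hdiv_norm N \<sigma> * sqrt L > 0"
    using L \<open>L2_inner \<sigma> \<sigma> \<ge> 0\<close> by (simp add: Hdiv)
  ultimately have "1 / 100 \<le> L2_inner (div_h N \<sigma>) v / (Hdiv_norm N \<sigma> * L2_norm v)"
    using L by (simp add: 1 L2_norm_def L_def[symmetric] field_simps)
  then show "ereal (1 / 100) \<le> (SUP \<sigma> \<in> {\<sigma> \<in> Sigma_h0 N. \<not> L2_zero \<sigma>}.
      ereal (L2_inner (div_h N \<sigma>) v / (Hdiv_norm N \<sigma> * L2_norm v)))"
    using \<sigma> z nz by (intro SUP_upper2[of \<sigma>]) auto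
qed

end
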